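(* Let $\Sigma$ be a complete simplicial locally convex fan. Let $\rho_{j_1},\dots,\rho_{j_m}$ be rays spanning a cone of $\Sigma$ and let $1\le r\le m$. Suppose that $-D_{j_r}|_{D_{j_1}\cap\dots\cap D_{j_m}}=0$ and that there is another ray $\alpha\in\operatorname{lk}_\Sigma(\sigma_{j_1,\dots,\widehat{j_r},\dots,j_m})$, $\alpha\ne\rho_{j_r}$, such that $-D_\alpha|_{D_\alpha\cap D_{j_1}\cap\dots\cap\widehat{D_{j_r}}\cap\dots\cap D_{j_m}}=0$ (equivalently, $|\operatorname{lk}_\Sigma(\alpha,\sigma_{j_1,\dots,\widehat{j_r},\dots,j_m})|\subset N(\sigma_{j_1,\dots,\widehat{j_r},\dots,j_m})_{\mathbb R}$ is a codimension 1 vector subspace). Then there is at most one such ray $\beta\in\operatorname{lk}_\Sigma(\sigma_{j_1,\dots,\widehat{j_r},\dots,j_m})$ (with $\beta\neq\rho_{j_r}$) that is not in $\operatorname{lk}_\Sigma(\rho_{j_r})$ (equivalently not in $\operatorname{lk}_\Sigma(\sigma_{j_1,\dots,j_m})$) and satisfies $-D_\beta|_{D_\beta\cap D_{j_1}\cap\dots\cap\widehat{D_{j_r}}\cap\dots\cap D_{j_m}}=0$; and the link of such a $\beta$ inside $\operatorname{lk}_\Sigma(\sigma_{j_1,\dots,\widehat{j_r},\dots,j_m})$ must have support $|\operatorname{lk}_\Sigma(\beta,\sigma_{j_1,\dots,\widehat{j_r},\dots,j_m})|=|\operatorname{lk}_\Sigma(\sigma_{j_1,\dots,j_m})|$ in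 $N(\sigma_{j_1,\dots,\widehat{j_r},\dots,j_m})_{\mathbb R}$.
   Context: A fan is locally convex if for every ray $\rho$ the union of all cones containing $\rho$ is convex. $D_\rho$ is the torus-invariant divisor of $\rho$, $D_{j_k}=D_{\rho_{j_k}}$, $\sigma_{j_1,\dots,j_m}=\operatorname{Cone}(\rho_{j_1},\dots,\rho_{j_m})$, a hat denotes omission. Divisor classes are with rational coefficients. $\operatorname{lk}_\Sigma(\omega)$ consists of cones $\tau\in\Sigma$ with $\tau\cap\omega=\{0\}$, $\tau+\omega\in\Sigma$, and $\operatorname{lk}_\Sigma(\alpha,\omega)$ is the link of the cone generated by $\alpha$ and $\omega$. $N(\omega)_{\mathbb R}=N_{\mathbb R}/\operatorname{Span}(\omega)$; supports $|\cdot|$ are unions of the images of the cones in the indicated space. *)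

theory Defs
  imports "HOL-Analysis.Analysis"
begin

section \<open>Fans\<close>

text \<open>
  The lattice is $N = \mathbb{Z}^n$ inside $N_{\mathbb R} = \mathbb{R}^n$. The dual lattice is
  identified with $N$ through the standard inner product, so that $\langle m, u\rangle$ is
  the inner product of $m$ and $u$, and $M_{\mathbb Q} = M \otimes \mathbb{Q}$ consists of the
  vectors with rational coordinates.
\<close>

definition lattice_N :: "(real ^ 'n) set" where
  "lattice_N = {x. \<forall>i. x $ i \<in> \<int>}"

definition M_rat :: "(real ^ 'n) set" where
  "M_rat = {x. \<forall>i. x $ i \<in> \<rat>}"

definition rational_polyhedral_cone :: "(real ^ 'n) set \<Rightarrow> bool" where
  "rational_polyhedral_cone \<sigma> \<longleftrightarrow>
     (\<exists>S. finite S \<and> S \<subseteq> lattice_N \<and> \<sigma> = convex_cone hull S)"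

definition strongly_convex :: "(real ^ 'n) set \<Rightarrow> bool" where
  "strongly_convex \<sigma> \<longleftrightarrow> \<sigma> \<inter> uminus ` \<sigma> = {0}"

text \<open>The relation \<open>face_of\<close> also admits the empty set, which is not a face of a cone here.\<close>

definition cone_face :: "(real ^ 'n) set \<Rightarrow> (real ^ 'n) set \<Rightarrow> bool" where
  "cone_face \<tau> \<sigma> \<longleftrightarrow> \<tau> face_of \<sigma> \<and> \<tau> \<noteq> {}"

definition fan :: "(real ^ 'n) set set \<Rightarrow> bool" where
  "fan \<Sigma> \<longleftrightarrow> finite \<Sigma> \<and>
     (\<forall>\<sigma>\<in>\<Sigma>. rational_polyhedral_cone \<sigma> \<and> strongly_convex \<sigma>) \<and>
     (\<forall>\<sigma>\<in>\<Sigma>. \<forall>\<tau>. cone_face \<tau> \<sigma> \<longrightarrow> \<tau> \<in> \<Sigma>) \<and>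
     (\<forall>\<sigma>\<in>\<Sigma>. \<forall>\<tau>\<in>\<Sigma>. cone_face (\<sigma> \<inter> \<tau>) \<sigma> \<and> cone_face (\<sigma> \<inter> \<tau>) \<tau>)"

definition complete_fan :: "(real ^ 'n) set set \<Rightarrow> bool" where
  "complete_fan \<Sigma> \<longleftrightarrow> \<Union>\<Sigma> = UNIV"

definition simplicial_fan :: "(real ^ 'n) set set \<Rightarrow> bool" where
  "simplicial_fan \<Sigma> \<longleftrightarrow> (\<forall>\<sigma>\<in>\<Sigma>. \<exists>S. independent S \<and> \<sigma> = convex_cone hull S)"

definition rays :: "(real ^ 'n) set set \<Rightarrow> (real ^ 'n) set set" where
  "rays \<Sigma> = {\<rho> \<in> \<Sigma>. dim \<rho> = 1}"

definition locally_convex :: "(real ^ 'n) set set \<Rightarrow> bool" where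
  "locally_convex \<Sigma> \<longleftrightarrow> (\<forall>\<rho>\<in>rays \<Sigma>. convex (\<Union>{\<sigma> \<in> \<Sigma>. \<rho> \<subseteq> \<sigma>}))"

definition Cone :: "(real ^ 'n) set set \<Rightarrow> (real ^ 'n) set" where
  "Cone R = convex_cone hull (\<Union>R)"

text \<open>Here \<open>\<tau> + \<omega>\<close> is the Minkowski sum.\<close>

definition link :: "(real ^ 'n) set set \<Rightarrow> (real ^ 'n) set \<Rightarrow> (real ^ 'n) set set" where
  "link \<Sigma> \<omega> = {\<tau> \<in> \<Sigma>. \<tau> \<inter> \<omega> = {0} \<and> \<tau> + \<omega> \<in> \<Sigma>}"


section \<open>The quotient space\<close>

text \<open>
  Elements of $N(\omega)_{\mathbb R} = N_{\mathbb R}/\mathrm{Span}(\omega)$ are represented as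
  cosets of \<open>span \<omega>\<close>.
\<close>

definition quot_map :: "(real ^ 'n) set \<Rightarrow> real ^ 'n \<Rightarrow> (real ^ 'n) set" where
  "quot_map \<omega> x = (\<lambda>w. x + w) ` span \<omega>"

definition quot_support :: "(real ^ 'n) set \<Rightarrow> (real ^ 'n) set set \<Rightarrow> (real ^ 'n) set set" where
  "quot_support \<omega> \<L> = (\<Union>\<tau>\<in>\<L>. quot_map \<omega> ` \<tau>)"

text \<open>
  The vector subspaces of $N_{\mathbb R}/\mathrm{Span}(\omega)$ are the images of the subspaces
  $H$ of $N_{\mathbb R}$ containing $\mathrm{Span}(\omega)$, with the same codimension as $H$.
\<close>

definition quot_codim1_subspace :: "(real ^ 'n) set \<Rightarrow> (real ^ 'n) set set \<Rightarrow> bool" where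
  "quot_codim1_subspace \<omega> Q \<longleftrightarrow>
     (\<exists>H. subspace H \<and> span \<omega> \<subseteq> H \<and> dim H + 1 = CARD('n) \<and> Q = quot_map \<omega> ` H)"


section \<open>Rational divisor classes on orbit closures\<close>

text \<open>
  For a cone \<open>\<sigma>\<close> of the fan, $V(\sigma)$ is the orbit closure, the toric variety of the star
  fan of \<open>\<sigma>\<close> in $N(\sigma)_{\mathbb R}$; if \<open>\<sigma>\<close> is spanned by the rays $\rho_1, \dots, \rho_m$,
  then $V(\sigma) = D_{\rho_1} \cap \dots \cap D_{\rho_m}$. The whole variety is $V(\{0\})$. The
  torus-invariant prime divisors of $V(\sigma)$ are the $V(\tau)$ for \<open>\<tau>\<close> in the following set.
\<close>

definition orbit_divisors :: "(real ^ 'n) set set \<Rightarrow> (real ^ 'n) set \<Rightarrow> (real ^ 'n) set set" where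
  "orbit_divisors \<Sigma> \<sigma> = {\<tau> \<in> \<Sigma>. \<sigma> \<subseteq> \<tau> \<and> dim \<tau> = dim \<sigma> + 1}"

text \<open>
  A lattice point whose class is the primitive generator of the ray that is the image of \<open>\<tau>\<close>
  in $N(\sigma)_{\mathbb R}$. It is unique modulo \<open>span \<sigma>\<close>, and is only paired with vectors
  of $\sigma^\perp$. For \<open>\<sigma> = {0}\<close> it is the primitive generator of the ray \<open>\<tau>\<close>.
\<close>

definition ray_gen :: "(real ^ 'n) set \<Rightarrow> (real ^ 'n) set \<Rightarrow> real ^ 'n" where
  "ray_gen \<sigma> \<tau> = (SOME u. u \<in> lattice_N \<and> quot_map \<sigma> u \<in> quot_map \<sigma> ` \<tau> \<and> u \<notin> span \<sigma> \<and>
     (\<forall>v\<in>lattice_N. quot_map \<sigma> v \<in> quot_map \<sigma> ` \<tau> \<longrightarrow>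
        (\<exists>k::nat. quot_map \<sigma> v = quot_map \<sigma> (real k *\<^sub>R u))))"

text \<open>
  Torus-invariant divisors on $V(\sigma)$ with rational coefficients: the coefficient of $V(\tau)$
  in \<open>E\<close> is \<open>E \<tau>\<close>.
\<close>

definition rat_divisors ::
    "(real ^ 'n) set set \<Rightarrow> (real ^ 'n) set \<Rightarrow> ((real ^ 'n) set \<Rightarrow> real) set" where
  "rat_divisors \<Sigma> \<sigma> = {E. (\<forall>\<tau>\<in>orbit_divisors \<Sigma> \<sigma>. E \<tau> \<in> \<rat>) \<and>
                            (\<forall>\<tau>. \<tau> \<notin> orbit_divisors \<Sigma> \<sigma> \<longrightarrow> E \<tau> = 0)}"

definition prime_divisor :: "(real ^ 'n) set \<Rightarrow> (real ^ 'n) set \<Rightarrow> real" where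
  "prime_divisor \<rho> = (\<lambda>\<tau>. if \<tau> = \<rho> then 1 else 0)"

text \<open>
  The divisor of the character $\chi^m$ on $V(\sigma)$, for \<open>m\<close> in
  $M(\sigma)_{\mathbb Q} = \sigma^\perp \cap M_{\mathbb Q}$.
\<close>

definition char_divisor ::
    "(real ^ 'n) set set \<Rightarrow> (real ^ 'n) set \<Rightarrow> real ^ 'n \<Rightarrow> (real ^ 'n) set \<Rightarrow> real" where
  "char_divisor \<Sigma> \<sigma> m = (\<lambda>\<tau>. if \<tau> \<in> orbit_divisors \<Sigma> \<sigma> then m \<bullet> ray_gen \<sigma> \<tau> else 0)"

definition lin_equiv ::
    "(real ^ 'n) set set \<Rightarrow> (real ^ 'n) set \<Rightarrow> ((real ^ 'n) set \<Rightarrow> real) \<Rightarrow> ((real ^ 'n) set \<Rightarrow> real) \<Rightarrow> bool"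
  where
  "lin_equiv \<Sigma> \<sigma> E E' \<longleftrightarrow> E \<in> rat_divisors \<Sigma> \<sigma> \<and> E' \<in> rat_divisors \<Sigma> \<sigma> \<and>
     (\<exists>m\<in>M_rat. (\<forall>x\<in>\<sigma>. m \<bullet> x = 0) \<and> E - E' = char_divisor \<Sigma> \<sigma> m)"

definition divisor_class ::
    "(real ^ 'n) set set \<Rightarrow> (real ^ 'n) set \<Rightarrow> ((real ^ 'n) set \<Rightarrow> real) \<Rightarrow> ((real ^ 'n) set \<Rightarrow> real) set"
  where
  "divisor_class \<Sigma> \<sigma> E = {E'. lin_equiv \<Sigma> \<sigma> E' E}"

text \<open>
  \<open>E\<close> is the restriction to $V(\sigma)$ of the $\mathbb{Q}$-Cartier divisor \<open>D\<close> on the whole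
  variety, where no component of \<open>D\<close> contains $V(\sigma)$: on the affine chart of a cone \<open>\<tau>\<close>
  the divisor \<open>D\<close> is given by a character $\chi^m$, which is then a local equation of the
  restriction too, so that $V(\tau)$ has coefficient \<open>m \<bullet> ray_gen \<sigma> \<tau>\<close> in it. The condition
  on \<open>D\<close> puts \<open>m\<close> in $\sigma^\perp$.
\<close>

definition divisor_restriction ::
    "(real ^ 'n) set set \<Rightarrow> (real ^ 'n) set \<Rightarrow> ((real ^ 'n) set \<Rightarrow> real) \<Rightarrow> ((real ^ 'n) set \<Rightarrow> real) \<Rightarrow> bool"
  where
  "divisor_restriction \<Sigma> \<sigma> D E \<longleftrightarrow>
     D \<in> rat_divisors \<Sigma> {0} \<and> E \<in> rat_divisors \<Sigma> \<sigma> \<and>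
     (\<forall>\<rho>\<in>rays \<Sigma>. \<rho> \<subseteq> \<sigma> \<longrightarrow> D \<rho> = 0) \<and>
     (\<forall>\<tau>\<in>orbit_divisors \<Sigma> \<sigma>. \<exists>m\<in>M_rat.
        (\<forall>\<rho>\<in>rays \<Sigma>. \<rho> \<subseteq> \<tau> \<longrightarrow> D \<rho> = m \<bullet> ray_gen {0} \<rho>) \<and> E \<tau> = m \<bullet> ray_gen \<sigma> \<tau>)"

text \<open>
  The restricted class: \<open>D\<close> is first moved in its class away from $V(\sigma)$.
\<close>

definition restricted_class ::
    "(real ^ 'n) set set \<Rightarrow> (real ^ 'n) set \<Rightarrow> ((real ^ 'n) set \<Rightarrow> real) \<Rightarrow> ((real ^ 'n) set \<Rightarrow> real) set"
  where
  "restricted_class \<Sigma> \<sigma> D =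
     {E. \<exists>D' E'. lin_equiv \<Sigma> {0} D' D \<and> divisor_restriction \<Sigma> \<sigma> D' E' \<and> lin_equiv \<Sigma> \<sigma> E E'}"

definition restricts_to_zero ::
    "(real ^ 'n) set set \<Rightarrow> ((real ^ 'n) set \<Rightarrow> real) \<Rightarrow> (real ^ 'n) set \<Rightarrow> bool" where
  "restricts_to_zero \<Sigma> D \<sigma> \<longleftrightarrow> restricted_class \<Sigma> \<sigma> D = divisor_class \<Sigma> \<sigma> (\<lambda>_. 0)"

end

theory Submission
  imports Defs
begin

text \<open>
  Write \<open>\<omega>\<close> for \<open>\<sigma>'\<close>. For a ray \<open>\<alpha>\<close> of the link of \<open>\<omega>\<close>, moving \<open>- D\<^sub>\<alpha>\<close> in its class shows that it
  restricts to zero on the orbit closure of \<open>\<alpha> + \<omega>\<close> iff there is a rational functional \<open>a\<close> with value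
  1 on the generator of \<open>\<alpha>\<close> that vanishes on \<open>\<omega>\<close> and on the link of \<open>\<alpha> + \<omega>\<close>. By completeness the
  link then fills the hyperplane \<open>a \<bullet> x = 0\<close> modulo the span of \<open>\<omega>\<close>, and the star of \<open>\<alpha> + \<omega>\<close> fills a
  half-space. Two such rays that do not span a cone have half-spaces without common interior points,
  hence opposite ones, with the same boundary. Two rays opposite to a third one have the same
  half-space, so each generator lies in the interior of the star of the other ray, and they agree.
  Local convexity enters only through the flag property of the fan.
\<close>

section \<open>Convex cones and inner products\<close>

text \<open>The star fan in the quotient is never built: a vector of \<open>span \<omega>\<close> is
  a difference of two vectors of \<open>\<omega>\<close>, so a statement modulo the span becomes
  membership of a translate by a vector of \<open>\<omega>\<close> in an actual cone. Two facts
  carry the geometry. Extremality: if the sum of two vectors of one cone lies in another cone of the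
  fan, so do the summands. Absorption: pushing any \<open>x\<close> far enough towards a relative
  interior point of a cone lands in the star of that cone. The functional arises as follows. If
  div(chi^m) - D_\<alpha> has no component containing the orbit closure, then \<open>m\<close> is 1
  on the generator of \<open>\<alpha>\<close> and 0 on \<open>\<omega>\<close>, hence fixed up to
  the annihilator of \<open>\<alpha> + \<omega>\<close>. A character \<open>m'\<close> in this
  annihilator that trivialises the restriction corrects \<open>m\<close> to
  \<open>a = m + m'\<close>, which also vanishes on the link. Divisor classes are rational, so
  \<open>a\<close> must be rational, whereas a hyperplane gives only a real functional. Cones are
  generated by lattice points, and orthogonal projection over the rationals closes this gap.\<close>

lemma convex_cone_sum:
  assumes "convex_cone C" and "\<And>i. i \<in> I \<Longrightarrow> f i \<in> C"
  shows "sum f I \<in> C"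
  using assms(2)
  by (induction I rule: infinite_finite_induct)
    (auto simp: convex_cone_contains_0[OF assms(1)] intro: convex_cone_add[OF assms(1)])

lemma convex_cone_hull_finite_sum:
  assumes "finite S" and "x \<in> convex_cone hull S"
  obtains c where "\<And>s. s \<in> S \<Longrightarrow> (0::real) \<le> c s" and "x = (\<Sum>s\<in>S. c s *\<^sub>R s)"
proof -
  let ?C = "{x. \<exists>c. (\<forall>s\<in>S. (0::real) \<le> c s) \<and> x = (\<Sum>s\<in>S. c s *\<^sub>R s)}"
  have "convex_cone ?C"
    unfolding convex_cone_iff
  proof (intro conjI allI ballI impI)
    show "0 \<in> ?C" by (auto intro!: exI[of _ "\<lambda>_. 0"])
  next
    fix x y assume "x \<in> ?C" "y \<in> ?C"
    then obtain c d where "\<forall>s\<in>S. (0::real) \<le> c s" "x = (\<Sum>s\<in>S. c s *\<^sub>R s)"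
      "\<forall>s\<in>S. (0::real) \<le> d s" "y = (\<Sum>s\<in>S. d s *\<^sub>R s)" by blast
    then show "x + y \<in> ?C"
      by (auto simp: scaleR_add_left sum.distrib intro!: exI[of _ "\<lambda>s. c s + d s"])
  next
    fix x and t :: real assume "x \<in> ?C" "0 \<le> t"
    then obtain c where "\<forall>s\<in>S. (0::real) \<le> c s" "x = (\<Sum>s\<in>S. c s *\<^sub>R s)" by blast
    with \<open>0 \<le> t\<close> show "t *\<^sub>R x \<in> ?C"
      by (auto simp: scaleR_sum_right intro!: exI[of _ "\<lambda>s. t * c s"])
  qed
  moreover have "S \<subseteq> ?C"
  proof
    fix s assume "s \<in> S"
    then have "s = (\<Sum>t\<in>S. (if t = s then 1 else 0) *\<^sub>R t)"
      using assms(1) by (simp add: if_distrib[of "\<lambda>c. c *\<^sub>R _"] cong: if_cong)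
    then show "s \<in> ?C"
      by (auto intro!: exI[of _ "\<lambda>t. if t = s then 1 else 0"])
  qed
  ultimately have "convex_cone hull S \<subseteq> ?C" by (rule hull_minimal[rotated])
  with assms(2) that show thesis by blast
qed

lemma convex_cone_hull_singleton:
  "convex_cone hull {u} = {c *\<^sub>R u | c. 0 \<le> c}"
proof
  show "convex_cone hull {u} \<subseteq> {c *\<^sub>R u | c. 0 \<le> c}"
    by (rule subsetI, erule convex_cone_hull_finite_sum[rotated]) auto
  show "{c *\<^sub>R u | c. 0 \<le> c} \<subseteq> convex_cone hull {u}"
    using convex_cone_hull_mul[OF hull_inc] by blast
qed

lemma convex_cone_hull_Un_plus:
  "convex_cone hull (S \<union> T) = convex_cone hull S + convex_cone hull T"
  by (auto simp: convex_cone_hull_Un set_plus_def)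

lemma span_convex_cone_hull: "span (convex_cone hull S) = span S"
proof
  show "span (convex_cone hull S) \<subseteq> span S"
    by (metis convex_cone_span hull_minimal span_minimal span_superset subspace_span)
  show "span S \<subseteq> span (convex_cone hull S)"
    by (simp add: hull_subset span_mono)
qed

lemma dim_convex_cone_hull:
  "independent S \<Longrightarrow> dim (convex_cone hull S) = card S"
  by (metis dim_eq_card_independent dim_span span_convex_cone_hull)

lemma convex_cone_subset_plus:
  assumes "convex_cone A" and "convex_cone B"
  shows "A \<subseteq> A + B" and "B \<subseteq> A + B"
proof -
  show "A \<subseteq> A + B"
    using set_plus_intro[OF _ convex_cone_contains_0[OF assms(2)]] by auto
  show "B \<subseteq> A + B"
    using set_plus_intro[OF convex_cone_contains_0[OF assms(1)]] by auto
qed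

lemma convex_cone_plus_least:
  assumes "convex_cone C" and "A \<subseteq> C" and "B \<subseteq> C"
  shows "A + B \<subseteq> C"
  using assms by (auto simp: set_plus_def intro!: convex_cone_add)

text \<open>\<open>x + y\<close> is the midpoint of \<open>2x\<close> and \<open>2y\<close>, so the
  face contains these endpoints, and a face of a cone is stable under scaling. This is the source of
  every extremality argument below.\<close>

lemma face_of_cone_summand:
  assumes "convex_cone C" and "F face_of C" and "x \<in> C" and "y \<in> C" and "x + y \<in> F"
  shows "x \<in> F"
proof -
  have F: "c *\<^sub>R z \<in> F" if "z \<in> F" "0 \<le> c" for c z
    using assms(1,2) face_of_conic that unfolding conic_def convex_cone_def by blast
  show ?thesis
  proof (cases "x = y")
    case True
    then show ?thesis using F[OF assms(5), of "1/2"] by (simp flip: scaleR_2)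
  next
    case False
    then have "x + y \<in> open_segment (2 *\<^sub>R x) (2 *\<^sub>R y)"
      unfolding in_segment by (auto intro!: exI[of _ "1/2"])
    moreover have "2 *\<^sub>R x \<in> C" "2 *\<^sub>R y \<in> C"
      using assms(1,3,4) by (auto intro: convex_cone_scaleR)
    ultimately have "2 *\<^sub>R x \<in> F" using assms(2,5) unfolding face_of_def by blast
    then show ?thesis using F[of "2 *\<^sub>R x" "1/2"] by simp
  qed
qed

text \<open>\<open>g\<close> sums the coordinates belonging to \<open>S - T\<close>. On the cone
  these are nonnegative, so their sum vanishes only if each of them does. Hence \<open>g\<close>
  exposes the face generated by \<open>T\<close>, and the complementary generators meet that face
  only in 0.\<close>

lemma independent_cone_functional:
  fixes S :: "'a::euclidean_space set"
  assumes "independent S" and "T \<subseteq> S"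
  obtains g :: "'a \<Rightarrow> real" where "linear g"
    and "\<And>x. x \<in> convex_cone hull S \<Longrightarrow> 0 \<le> g x"
    and "\<And>x. x \<in> convex_cone hull S \<Longrightarrow> g x = 0 \<longleftrightarrow> x \<in> convex_cone hull T"
    and "\<And>x. x \<in> convex_cone hull (S - T) \<Longrightarrow> g x = 0 \<Longrightarrow> x = 0"
proof -
  have fin: "finite S" by (rule independent_imp_finite[OF assms(1)])
  obtain g :: "'a \<Rightarrow> real" where g: "linear g" "\<forall>x\<in>S. g x = (if x \<in> T then 0 else 1)"
    using linear_independent_extend[OF assms(1), of "\<lambda>x. if x \<in> T then 0 else 1"] by blast
  have g_sum: "g (\<Sum>s\<in>U. c s *\<^sub>R s) = (\<Sum>s\<in>U - T. c s)" if "U \<subseteq> S" for U c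
  proof -
    have "g (\<Sum>s\<in>U. c s *\<^sub>R s) = (\<Sum>s\<in>U. c s * g s)"
      using g(1) by (simp add: linear_sum linear_cmul)
    also have "\<dots> = (\<Sum>s\<in>U. if s \<in> T then 0 else c s)"
      using g(2) that by (intro sum.cong) auto
    also have "\<dots> = (\<Sum>s\<in>U - T. c s)"
      using finite_subset[OF that fin] by (intro sum.mono_neutral_cong_right) auto
    finally show ?thesis .
  qed
  show thesis
  proof (rule that[OF g(1)])
    fix x assume x: "x \<in> convex_cone hull S"
    obtain c where c: "\<And>s. s \<in> S \<Longrightarrow> 0 \<le> c s" "x = (\<Sum>s\<in>S. c s *\<^sub>R s)"
      using convex_cone_hull_finite_sum[OF fin x] by blast
    have gx: "g x = (\<Sum>s\<in>S - T. c s)" using g_sum[of S c] c(2) by simp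
    show "0 \<le> g x" unfolding gx using c(1) by (auto intro: sum_nonneg)
    show "g x = 0 \<longleftrightarrow> x \<in> convex_cone hull T"
    proof
      assume "g x = 0"
      then have 0: "c s = 0" if "s \<in> S - T" for s
        using that c(1) fin unfolding gx by (subst (asm) sum_nonneg_eq_0_iff) auto
      have x_eq: "x = (\<Sum>s\<in>T. c s *\<^sub>R s)"
        unfolding c(2) using fin assms(2) 0 by (intro sum.mono_neutral_right) auto
      have mem: "c s *\<^sub>R s \<in> convex_cone hull T" if "s \<in> T" for s
        using convex_cone_hull_mul[OF hull_inc[OF that] c(1)] assms(2) that by blast
      show "x \<in> convex_cone hull T"
        unfolding x_eq by (intro convex_cone_sum[OF convex_cone_convex_cone_hull] mem)
    next
      assume xT: "x \<in> convex_cone hull T"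
      obtain d where "x = (\<Sum>s\<in>T. d s *\<^sub>R s)"
        using convex_cone_hull_finite_sum[OF finite_subset[OF assms(2) fin] xT] by blast
      then show "g x = 0" using g_sum[OF assms(2), of d] by simp
    qed
  next
    fix x assume x: "x \<in> convex_cone hull (S - T)" and gx: "g x = 0"
    have fin': "finite (S - T)" using fin by simp
    obtain c where c: "\<And>s. s \<in> S - T \<Longrightarrow> 0 \<le> c s" "x = (\<Sum>s\<in>S - T. c s *\<^sub>R s)"
      using convex_cone_hull_finite_sum[OF fin' x] by blast
    have "(\<Sum>s\<in>S - T. c s) = 0" using g_sum[of "S - T" c] c(2) gx by simp
    then have "\<forall>s\<in>S - T. c s = 0"
      using c(1) fin' by (subst (asm) sum_nonneg_eq_0_iff) auto
    then show "x = 0" using c(2) by simp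
  qed
qed

lemma cone_face_convex_cone_hull:
  fixes S :: "(real ^ 'n) set"
  assumes "independent S" and "T \<subseteq> S"
  shows "cone_face (convex_cone hull T) (convex_cone hull S)"
proof -
  obtain g :: "real ^ 'n \<Rightarrow> real" where g: "linear g"
    "\<And>x. x \<in> convex_cone hull S \<Longrightarrow> 0 \<le> g x"
    "\<And>x. x \<in> convex_cone hull S \<Longrightarrow> g x = 0 \<longleftrightarrow> x \<in> convex_cone hull T"
    by (rule independent_cone_functional[OF assms]) blast
  have sub: "convex_cone hull T \<subseteq> convex_cone hull S"
    by (rule hull_mono[OF assms(2)])
  have "a \<in> convex_cone hull T \<and> b \<in> convex_cone hull T"
    if ab: "a \<in> convex_cone hull S" "b \<in> convex_cone hull S"
      and x: "x \<in> convex_cone hull T" "x \<in> open_segment a b" for a b x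
  proof -
    obtain t where t: "0 < t" "t < 1" "x = (1 - t) *\<^sub>R a + t *\<^sub>R b"
      using x(2) unfolding in_segment by blast
    have "g x = 0" using g(3) sub x(1) by blast
    then have "(1 - t) * g a + t * g b = 0"
      using t(3) g(1) by (simp add: linear_add linear_cmul)
    then have "(1 - t) * g a = 0 \<and> t * g b = 0"
      using g(2)[OF ab(1)] g(2)[OF ab(2)] t(1,2) by (subst (asm) add_nonneg_eq_0_iff) auto
    then show ?thesis using g(3) ab t by simp
  qed
  then show ?thesis
    unfolding cone_face_def face_of_def
    using sub convex_convex_cone_hull convex_cone_hull_nonempty by blast
qed

lemma inner_span_eq_0:
  assumes "\<And>s. s \<in> S \<Longrightarrow> a \<bullet> s = 0" and "x \<in> span S"
  shows "a \<bullet> x = 0"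
  using orthogonal_to_span[OF assms(2), of a] assms(1) by (simp add: orthogonal_def)

text \<open>The differences of elements of a convex cone already form a subspace. This turns
  congruences modulo \<open>span \<omega>\<close> into equations between elements of cones.\<close>

lemma span_convex_cone:
  assumes "convex_cone C" and "w \<in> span C"
  obtains x y where "x \<in> C" and "y \<in> C" and "w = x - y"
proof -
  let ?D = "{x - y | x y. x \<in> C \<and> y \<in> C}"
  have add: "x + y \<in> C" if "x \<in> C" "y \<in> C" for x y
    using that by (rule convex_cone_add[OF assms(1)])
  have "subspace ?D"
  proof (rule subspaceI)
    show "0 \<in> ?D" using convex_cone_contains_0[OF assms(1)] by force
  next
    fix v w assume "v \<in> ?D" "w \<in> ?D"
    then obtain x y x' y' where "x \<in> C" "y \<in> C" "v = x - y" "x' \<in> C" "y' \<in> C" "w = x' - y'"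
      by blast
    then have "v + w = (x + x') - (y + y')" "x + x' \<in> C" "y + y' \<in> C" using add by auto
    then show "v + w \<in> ?D" by blast
  next
    fix c :: real and v assume "v \<in> ?D"
    then obtain x y where v: "x \<in> C" "y \<in> C" "v = x - y" by blast
    show "c *\<^sub>R v \<in> ?D"
    proof (cases "0 \<le> c")
      case True
      then have "c *\<^sub>R x \<in> C" "c *\<^sub>R y \<in> C"
        using v convex_cone_scaleR[OF assms(1)] by auto
      then show ?thesis using v(3) scaleR_diff_right by blast
    next
      case False
      then have "(- c) *\<^sub>R y \<in> C" "(- c) *\<^sub>R x \<in> C"
        using v convex_cone_scaleR[OF assms(1), of "- c"] by auto
      moreover have "c *\<^sub>R v = (- c) *\<^sub>R y - (- c) *\<^sub>R x"
        using v(3) by (simp add: scaleR_diff_right)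
      ultimately show ?thesis by blast
    qed
  qed
  moreover have "C \<subseteq> ?D" using convex_cone_contains_0[OF assms(1)] by force
  ultimately have "span C \<subseteq> ?D" by (rule span_minimal[rotated])
  with assms(2) that show thesis by blast
qed

lemma opposite_vectors:
  fixes a b :: "'a::real_inner"
  assumes "a \<noteq> 0" and "b \<noteq> 0" and "\<And>x. 0 < a \<bullet> x \<Longrightarrow> b \<bullet> x \<le> 0"
  obtains c where "0 < c" and "b = - c *\<^sub>R a"
proof -
  \<comment> \<open>The bisector of \<open>a\<close> and \<open>b\<close>: its products with both
    have the sign of \<open>norm a * norm b + a \<bullet> b\<close>, which therefore cannot be
    positive. Cauchy-Schwarz then holds with equality for \<open>a\<close> and
    \<open>-b\<close>.\<close>
  define x where "x = norm b *\<^sub>R a + norm a *\<^sub>R b"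
  have ax: "a \<bullet> x = norm a * (norm a * norm b + a \<bullet> b)"
    unfolding x_def by (simp add: inner_add_right dot_square_norm power2_eq_square algebra_simps)
  have bx: "b \<bullet> x = norm b * (norm a * norm b + a \<bullet> b)"
    unfolding x_def
    by (simp add: inner_add_right dot_square_norm power2_eq_square algebra_simps inner_commute)
  have "\<not> 0 < norm a * norm b + a \<bullet> b"
    using assms(3)[of x] assms(1,2) unfolding ax bx
    by (auto simp: zero_less_mult_iff mult_le_0_iff)
  moreover have "0 \<le> norm a * norm b + a \<bullet> b"
    using norm_cauchy_schwarz[of a "- b"] by simp
  ultimately have "a \<bullet> (- b) = norm a * norm (- b)" by simp
  then have "norm a *\<^sub>R (- b) = norm (- b) *\<^sub>R a" by (simp only: norm_cauchy_schwarz_eq)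
  then have "(1 / norm a) *\<^sub>R (norm a *\<^sub>R (- b)) = (1 / norm a) *\<^sub>R (norm b *\<^sub>R a)"
    by simp
  then have "- b = (norm b / norm a) *\<^sub>R a" using assms(1) by simp
  then have "b = - (norm b / norm a) *\<^sub>R a" by (metis add.inverse_inverse scaleR_minus_left)
  then show thesis using that[of "norm b / norm a"] assms(1,2) by simp
qed

section \<open>Rational functionals\<close>

lemma M_rat_diff: "a \<in> M_rat \<Longrightarrow> b \<in> M_rat \<Longrightarrow> a - b \<in> M_rat"
  and M_rat_add: "a \<in> M_rat \<Longrightarrow> b \<in> M_rat \<Longrightarrow> a + b \<in> M_rat"
  and M_rat_scaleR: "c \<in> \<rat> \<Longrightarrow> a \<in> M_rat \<Longrightarrow> c *\<^sub>R a \<in> M_rat"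
  and M_rat_zero: "0 \<in> M_rat"
  by (simp_all add: M_rat_def)

lemma lattice_N_subset_M_rat: "lattice_N \<subseteq> M_rat"
  using Ints_subset_Rats unfolding lattice_N_def M_rat_def by blast

lemma Rats_inner: "a \<in> M_rat \<Longrightarrow> b \<in> M_rat \<Longrightarrow> a \<bullet> b \<in> \<rat>"
  unfolding inner_vec_def M_rat_def by (auto intro!: Rats_sum Rats_mult)

lemma Ints_inner: "a \<in> lattice_N \<Longrightarrow> b \<in> lattice_N \<Longrightarrow> a \<bullet> b \<in> \<int>"
  unfolding inner_vec_def lattice_N_def by (auto intro!: Ints_sum Ints_mult)

text \<open>Gram-Schmidt over the rationals: \<open>p\<close> is the orthogonal projection of
  \<open>e\<close> to \<open>span S\<close>, and each step only divides rational inner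
  products.\<close>

lemma rational_projection:
  assumes "finite S" and "S \<subseteq> M_rat" and "e \<in> M_rat"
  shows "\<exists>p\<in>span S. p \<in> M_rat \<and> (\<forall>s\<in>S. (e - p) \<bullet> s = 0)"
  using assms
proof (induction S arbitrary: e rule: finite_induct)
  case empty
  then show ?case by (auto simp: M_rat_zero)
next
  case (insert s S)
  obtain p where p: "p \<in> span S" "p \<in> M_rat" "\<forall>t\<in>S. (e - p) \<bullet> t = 0"
    using insert by (metis insert_subset)
  obtain q where q: "q \<in> span S" "q \<in> M_rat" "\<forall>t\<in>S. (s - q) \<bullet> t = 0"
    using insert by (metis insert_subset)
  define s' where "s' = s - q"
  \<comment> \<open>\<open>s'\<close> is the part of \<open>s\<close> orthogonal to
    \<open>S\<close>. If it is 0, division by zero gives \<open>c = 0\<close>, and nothing needs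
    correcting.\<close>
  define c where "c = ((e - p) \<bullet> s') / (s' \<bullet> s')"
  have s': "s' \<in> M_rat" unfolding s'_def using insert.prems q(2) by (auto intro: M_rat_diff)
  have "p + c *\<^sub>R s' \<in> span (insert s S)"
  proof -
    have "p \<in> span (insert s S)" "q \<in> span (insert s S)" "s \<in> span (insert s S)"
      using p(1) q(1) span_mono[of S "insert s S"] by (auto intro: span_base)
    then show ?thesis unfolding s'_def by (intro span_add span_scale span_diff)
  qed
  moreover have "p + c *\<^sub>R s' \<in> M_rat"
    unfolding c_def using p(2) s' insert.prems(2)
    by (intro M_rat_add M_rat_scaleR Rats_divide Rats_inner M_rat_diff)
  moreover have "(e - (p + c *\<^sub>R s')) \<bullet> t = 0" if "t \<in> insert s S" for t
  proof -
    have S: "(e - (p + c *\<^sub>R s')) \<bullet> t = 0" if "t \<in> S" for t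
    proof -
      have "(e - (p + c *\<^sub>R s')) \<bullet> t = (e - p) \<bullet> t - c * (s' \<bullet> t)"
        by (simp add: inner_diff_left inner_add_left)
      then show ?thesis using p(3) q(3) that by (simp add: s'_def)
    qed
    have "(e - (p + c *\<^sub>R s')) \<bullet> s' = (e - p) \<bullet> s' - c * (s' \<bullet> s')"
      by (simp add: inner_diff_left inner_add_left)
    also have "\<dots> = 0" unfolding c_def by (cases "s' = 0") auto
    finally have "(e - (p + c *\<^sub>R s')) \<bullet> s' = 0" .
    moreover have "(e - (p + c *\<^sub>R s')) \<bullet> q = 0"
      using S q(1) by (rule inner_span_eq_0)
    ultimately have "(e - (p + c *\<^sub>R s')) \<bullet> s = 0"
      unfolding s'_def by (simp add: inner_diff_right)
    with S that show ?thesis by blast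
  qed
  ultimately show ?case by blast
qed

text \<open>The part \<open>q\<close> of \<open>e\<close> orthogonal to \<open>span S\<close> is
  rational and nonzero, and \<open>q \<bullet> e = q \<bullet> q\<close>, so it can be normalised.
  \<open>S\<close> may be infinite, as the lattice points of a cone are, hence the passage to a
  basis \<open>B\<close>.\<close>

lemma rational_functional:
  assumes "S \<subseteq> M_rat" and "e \<in> M_rat" and "e \<notin> span S"
  obtains a where "a \<in> M_rat" and "\<And>s. s \<in> S \<Longrightarrow> a \<bullet> s = 0" and "a \<bullet> e = 1"
proof -
  obtain B where B: "B \<subseteq> S" "independent B" "S \<subseteq> span B"
    using maximal_independent_subset[of S] by blast
  have "finite B" using B(2) by (rule independent_imp_finite)
  then obtain p where p: "p \<in> span B" "p \<in> M_rat" "\<forall>s\<in>B. (e - p) \<bullet> s = 0"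
    using rational_projection[of B e] B(1) assms by blast
  define q where "q = e - p"
  have B0: "q \<bullet> x = 0" if "x \<in> span B" for x
    by (rule inner_span_eq_0[OF _ that]) (use p(3) q_def in auto)
  have "e \<noteq> p" using p(1) span_mono[OF B(1)] assms(3) by blast
  then have "q \<bullet> q \<noteq> 0" unfolding q_def by simp
  then have qe: "q \<bullet> e \<noteq> 0" using B0[OF p(1)] unfolding q_def by (simp add: inner_diff_right)
  have q: "q \<in> M_rat" unfolding q_def using assms(2) p(2) by (rule M_rat_diff)
  show thesis
  proof
    show "(1 / (q \<bullet> e)) *\<^sub>R q \<in> M_rat"
      using q assms(2) by (intro M_rat_scaleR Rats_divide Rats_inner) auto
    show "((1 / (q \<bullet> e)) *\<^sub>R q) \<bullet> s = 0" if "s \<in> S" for s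
      using B0 B(3) that by auto
    show "((1 / (q \<bullet> e)) *\<^sub>R q) \<bullet> e = 1" using qe by simp
  qed
qed

lemma M_rat_denominator:
  assumes "a \<in> M_rat"
  obtains N :: nat where "0 < N" and "real N *\<^sub>R a \<in> lattice_N"
proof -
  have "\<exists>N::nat. 0 < N \<and> (\<forall>i\<in>I. real N * a $ i \<in> \<int>)" if "finite I" for I
    using that
  proof induction
    case empty
    show ?case by (auto intro: exI[of _ 1])
  next
    case (insert i I)
    obtain N :: nat where N: "0 < N" "\<forall>i\<in>I. real N * a $ i \<in> \<int>" using insert.IH by blast
    have "a $ i \<in> \<rat>" using assms unfolding M_rat_def by blast
    then obtain p q where pq: "q > 0" "a $ i = of_int p / of_int q"
      by (elim Rats_cases') auto
    have "real (N * nat q) * a $ i = of_int (int N * p)" using pq by simp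
    then have "real (N * nat q) * a $ i \<in> \<int>" by (metis Ints_of_int)
    moreover have "real (N * nat q) * a $ j \<in> \<int>" if "j \<in> I" for j
    proof -
      have "real (nat q) * (real N * a $ j) \<in> \<int>" 
        by (rule Ints_mult[OF Ints_of_nat bspec[OF N(2) that]])
      then show ?thesis by (simp add: mult_ac)
    qed
    ultimately show ?case using N(1) pq(1) by (intro exI[of _ "N * nat q"]) auto
  qed
  from this[of UNIV] that show thesis unfolding lattice_N_def by auto
qed

section \<open>Quotients and divisor classes\<close>

lemma quot_map_eq_iff: "quot_map \<omega> x = quot_map \<omega> y \<longleftrightarrow> x - y \<in> span \<omega>"
proof
  assume "quot_map \<omega> x = quot_map \<omega> y"
  moreover have "x \<in> quot_map \<omega> x" unfolding quot_map_def using span_zero by force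
  ultimately have "x \<in> quot_map \<omega> y" by simp
  then show "x - y \<in> span \<omega>" unfolding quot_map_def by auto
next
  have sub: "quot_map \<omega> x \<subseteq> quot_map \<omega> y" if "x - y \<in> span \<omega>" for x y
  proof
    fix z assume "z \<in> quot_map \<omega> x"
    then obtain w where "w \<in> span \<omega>" "z = x + w" unfolding quot_map_def by blast
    then have "z = y + ((x - y) + w)" "(x - y) + w \<in> span \<omega>"
      using that by (auto intro: span_add)
    then show "z \<in> quot_map \<omega> y" unfolding quot_map_def by blast
  qed
  assume "x - y \<in> span \<omega>"
  moreover from this have "y - x \<in> span \<omega>" using span_neg by fastforce
  ultimately show "quot_map \<omega> x = quot_map \<omega> y" using sub by blast
qed

lemma quot_map_image_iff: "quot_map \<omega> x \<in> quot_map \<omega> ` A \<longleftrightarrow> (\<exists>t\<in>A. x - t \<in> span \<omega>)"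
  by (auto simp: image_iff quot_map_eq_iff)

lemma Cone_insert: "Cone (insert \<alpha> R) = convex_cone hull \<alpha> + Cone R"
  unfolding Cone_def by (simp add: convex_cone_hull_Un_plus)

lemma lin_equiv_trans:
  assumes "lin_equiv \<Sigma> \<sigma> E E'" and "lin_equiv \<Sigma> \<sigma> E' E''"
  shows "lin_equiv \<Sigma> \<sigma> E E''"
proof -
  obtain m where m: "m \<in> M_rat" "\<forall>x\<in>\<sigma>. m \<bullet> x = 0" "E - E' = char_divisor \<Sigma> \<sigma> m"
    using assms(1) unfolding lin_equiv_def by blast
  obtain m' where m': "m' \<in> M_rat" "\<forall>x\<in>\<sigma>. m' \<bullet> x = 0" "E' - E'' = char_divisor \<Sigma> \<sigma> m'"
    using assms(2) unfolding lin_equiv_def by blast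
  have "E - E'' = char_divisor \<Sigma> \<sigma> (m + m')"
  proof
    fix \<tau>
    show "(E - E'') \<tau> = char_divisor \<Sigma> \<sigma> (m + m') \<tau>"
      using fun_cong[OF m(3), of \<tau>] fun_cong[OF m'(3), of \<tau>]
      by (auto simp: char_divisor_def inner_add_left split: if_splits)
  qed
  moreover have "m + m' \<in> M_rat" using m(1) m'(1) by (rule M_rat_add)
  moreover have "\<forall>x\<in>\<sigma>. (m + m') \<bullet> x = 0" using m(2) m'(2) by (simp add: inner_add_left)
  ultimately show ?thesis using assms unfolding lin_equiv_def by blast
qed

lemma divisor_restriction_local_equation:
  assumes "divisor_restriction \<Sigma> \<sigma> D E" and "\<tau> \<in> orbit_divisors \<Sigma> \<sigma>"
  obtains n where "\<And>\<rho>. \<rho> \<in> rays \<Sigma> \<Longrightarrow> \<rho> \<subseteq> \<tau> \<Longrightarrow> D \<rho> = n \<bullet> ray_gen {0} \<rho>"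
    and "E \<tau> = n \<bullet> ray_gen \<sigma> \<tau>"
proof -
  have "\<exists>n\<in>M_rat. (\<forall>\<rho>\<in>rays \<Sigma>. \<rho> \<subseteq> \<tau> \<longrightarrow> D \<rho> = n \<bullet> ray_gen {0} \<rho>) \<and>
      E \<tau> = n \<bullet> ray_gen \<sigma> \<tau>"
    using assms unfolding divisor_restriction_def by simp
  then show thesis using that by auto
qed

lemma zero_rat_divisor: "(\<lambda>_. 0) \<in> rat_divisors \<Sigma> \<sigma>"
  by (simp add: rat_divisors_def)

lemma lin_equiv_zero_refl: "lin_equiv \<Sigma> \<sigma> (\<lambda>_. 0) (\<lambda>_. 0)"
  unfolding lin_equiv_def using zero_rat_divisor M_rat_zero
  by (auto intro!: bexI[of _ 0] simp: char_divisor_def)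

section \<open>Complete simplicial fans\<close>

locale complete_simplicial_fan =
  fixes \<Sigma> :: "(real ^ 'n) set set"
  assumes fan: "fan \<Sigma>" and complete: "complete_fan \<Sigma>"
    and simplicial: "simplicial_fan \<Sigma>"
begin

section \<open>Faces of cones and subsets of generators\<close>

lemma cone_generators:
  assumes "\<gamma> \<in> \<Sigma>"
  obtains S where "finite S" and "independent S" and "\<gamma> = convex_cone hull S"
  using assms simplicial independent_imp_finite unfolding simplicial_fan_def by blast

lemma convex_cone_mem: "\<gamma> \<in> \<Sigma> \<Longrightarrow> convex_cone \<gamma>"
  by (metis cone_generators convex_cone_convex_cone_hull)

lemma zero_mem: "\<gamma> \<in> \<Sigma> \<Longrightarrow> 0 \<in> \<gamma>"
  by (simp add: convex_cone_contains_0 convex_cone_mem)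

lemma closed_mem: "\<gamma> \<in> \<Sigma> \<Longrightarrow> closed \<gamma>"
  by (metis cone_generators closed_convex_cone_hull)

text \<open>Two cones of a fan meet in a common face, and a face absorbs the summands of its
  elements. The fan axiom on intersections is used in this form from here on.\<close>

lemma summand_mem:
  assumes "\<gamma> \<in> \<Sigma>" and "\<delta> \<in> \<Sigma>" and "x \<in> \<gamma>" and "y \<in> \<gamma>" and "x + y \<in> \<delta>"
  shows "x \<in> \<delta>"
proof -
  have "(\<gamma> \<inter> \<delta>) face_of \<gamma>"
    using fan assms(1,2) unfolding fan_def cone_face_def by blast
  moreover have "x + y \<in> \<gamma> \<inter> \<delta>"
    using assms by (simp add: convex_cone_add convex_cone_mem)
  ultimately show ?thesis
    using face_of_cone_summand[OF convex_cone_mem[OF assms(1)]] assms(3,4) by blast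
qed

lemma subset_generators_mem:
  assumes "independent S" and "convex_cone hull S \<in> \<Sigma>" and "T \<subseteq> S"
  shows "convex_cone hull T \<in> \<Sigma>"
  using fan assms cone_face_convex_cone_hull[OF assms(1,3)] unfolding fan_def by blast

text \<open>In an expansion of \<open>x \<in> \<delta>\<close> over \<open>S\<close>, every term is
  a summand of \<open>x\<close>, so extremality puts it into \<open>\<delta>\<close>; each generator
  with a nonzero coefficient therefore lies in \<open>\<delta>\<close>.\<close>

lemma subcone_generators:
  assumes "finite S" and "convex_cone hull S \<in> \<Sigma>" and "\<delta> \<in> \<Sigma>" and "\<delta> \<subseteq> convex_cone hull S"
  shows "\<delta> = convex_cone hull (S \<inter> \<delta>)"
proof
  show "convex_cone hull (S \<inter> \<delta>) \<subseteq> \<delta>"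
    by (simp add: hull_minimal convex_cone_mem assms(3))
  show "\<delta> \<subseteq> convex_cone hull (S \<inter> \<delta>)"
  proof
    fix x assume x: "x \<in> \<delta>"
    then have "x \<in> convex_cone hull S" using assms(4) by blast
    then obtain c where c: "\<And>s. s \<in> S \<Longrightarrow> 0 \<le> c s" "x = (\<Sum>s\<in>S. c s *\<^sub>R s)"
      using convex_cone_hull_finite_sum[OF assms(1)] by blast
    have summand: "c s *\<^sub>R s \<in> convex_cone hull S" if "s \<in> S" for s
      using convex_cone_hull_mul[OF hull_inc[OF that] c(1)[OF that]] .
    have "c s *\<^sub>R s \<in> convex_cone hull (S \<inter> \<delta>)" if s: "s \<in> S" for s
    proof (cases "c s = 0")
      case True
      then show ?thesis by (simp add: convex_cone_hull_contains_0)
    next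
      case False
      have "x = c s *\<^sub>R s + (\<Sum>t\<in>S - {s}. c t *\<^sub>R t)"
        unfolding c(2) using s assms(1) by (simp add: sum.remove)
      moreover have "(\<Sum>t\<in>S - {s}. c t *\<^sub>R t) \<in> convex_cone hull S"
        using summand by (auto intro!: convex_cone_sum[OF convex_cone_convex_cone_hull])
      ultimately have "c s *\<^sub>R s \<in> \<delta>"
        using summand_mem[OF assms(2,3) summand[OF s]] x by metis
      then have "(1 / c s) *\<^sub>R (c s *\<^sub>R s) \<in> \<delta>"
        using c(1)[OF s]
        by (intro convex_cone_scaleR[OF convex_cone_mem[OF assms(3)], of "1 / c s"]) auto
      then have "s \<in> S \<inter> \<delta>" using False s by simp
      then show ?thesis using c(1)[OF s] by (intro convex_cone_hull_mul hull_inc)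
    qed
    then show "x \<in> convex_cone hull (S \<inter> \<delta>)"
      unfolding c(2) by (intro convex_cone_sum[OF convex_cone_convex_cone_hull])
  qed
qed

text \<open>Both cones are generated by subsets of the independent generators of
  \<open>\<gamma>\<close>, and the union of these subsets generates a face of
  \<open>\<gamma>\<close>. This is how rays in a common cone are seen to span a cone of the
  fan.\<close>

lemma plus_mem:
  assumes "\<gamma> \<in> \<Sigma>" and "\<delta>\<^sub>1 \<in> \<Sigma>" and "\<delta>\<^sub>2 \<in> \<Sigma>" and "\<delta>\<^sub>1 \<subseteq> \<gamma>" and "\<delta>\<^sub>2 \<subseteq> \<gamma>"
  shows "\<delta>\<^sub>1 + \<delta>\<^sub>2 \<in> \<Sigma>"
proof -
  obtain S where S: "finite S" "independent S" "\<gamma> = convex_cone hull S"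
    using cone_generators[OF assms(1)] .
  have "\<delta>\<^sub>1 + \<delta>\<^sub>2 = convex_cone hull (S \<inter> \<delta>\<^sub>1 \<union> S \<inter> \<delta>\<^sub>2)"
    using subcone_generators[of S \<delta>\<^sub>1] subcone_generators[of S \<delta>\<^sub>2] S assms
    by (simp add: convex_cone_hull_Un_plus)
  moreover have "convex_cone hull (S \<inter> \<delta>\<^sub>1 \<union> S \<inter> \<delta>\<^sub>2) \<in> \<Sigma>"
    using S(3) assms(1) by (auto intro!: subset_generators_mem[OF S(2), of "S \<inter> \<delta>\<^sub>1 \<union> S \<inter> \<delta>\<^sub>2"])
  ultimately show ?thesis by simp
qed

text \<open>\<open>\<tau>\<close> is the face of \<open>\<gamma>\<close> opposite to
  \<open>\<omega>\<close>, generated by the generators of \<open>\<gamma>\<close> that are not in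
  \<open>\<omega>\<close>.\<close>

lemma link_decomposition:
  assumes "\<gamma> \<in> \<Sigma>" and "\<omega> \<in> \<Sigma>" and "\<omega> \<subseteq> \<gamma>"
  obtains \<tau> where "\<tau> \<in> link \<Sigma> \<omega>" and "\<gamma> = \<tau> + \<omega>"
proof -
  obtain S where S: "finite S" "independent S" "\<gamma> = convex_cone hull S"
    using cone_generators[OF assms(1)] .
  define T where "T = S \<inter> \<omega>"
  have \<omega>: "\<omega> = convex_cone hull T"
    unfolding T_def using subcone_generators[OF S(1)] S(3) assms by blast
  let ?\<tau> = "convex_cone hull (S - T)"
  have TS: "T \<subseteq> S" "S = (S - T) \<union> T" unfolding T_def by blast+
  have sum: "\<gamma> = ?\<tau> + \<omega>"
    unfolding S(3) \<omega> using convex_cone_hull_Un_plus TS(2) by metis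
  obtain g :: "real ^ 'n \<Rightarrow> real" where g: "linear g"
    "\<And>x. x \<in> convex_cone hull S \<Longrightarrow> 0 \<le> g x"
    "\<And>x. x \<in> convex_cone hull S \<Longrightarrow> g x = 0 \<longleftrightarrow> x \<in> convex_cone hull T"
    "\<And>x. x \<in> convex_cone hull (S - T) \<Longrightarrow> g x = 0 \<Longrightarrow> x = 0"
    using independent_cone_functional[OF S(2) TS(1)] by metis
  have "?\<tau> \<inter> \<omega> \<subseteq> {0}"
    using g(3,4) assms(3) \<omega> S(3) by blast
  then have "?\<tau> \<inter> \<omega> = {0}"
    using zero_mem[OF assms(2)] convex_cone_hull_contains_0 by blast
  moreover have "?\<tau> \<in> \<Sigma>"
    using subset_generators_mem[OF S(2)] S(3) assms(1) by blast
  ultimately have "?\<tau> \<in> link \<Sigma> \<omega>"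
    unfolding link_def using sum assms(1) by auto
  then show thesis using that sum by blast
qed

lemma relative_interior_point:
  assumes "\<omega> \<in> \<Sigma>"
  obtains p where "p \<in> \<omega>" and "\<And>\<gamma>. \<gamma> \<in> \<Sigma> \<Longrightarrow> p \<in> \<gamma> \<Longrightarrow> \<omega> \<subseteq> \<gamma>"
proof -
  obtain S where S: "finite S" "independent S" "\<omega> = convex_cone hull S"
    using cone_generators[OF assms] .
  have mem: "s \<in> \<omega>" if "s \<in> S" for s using that S(3) by (simp add: hull_inc)
  \<comment> \<open>The sum of the generators serves as \<open>p\<close>: each generator is a
    summand of it, so a cone containing the sum contains them all.\<close>
  have "\<Sum>S \<in> \<omega>"
    using mem by (auto intro!: convex_cone_sum[OF convex_cone_mem[OF assms]])
  moreover have "\<omega> \<subseteq> \<gamma>" if \<gamma>: "\<gamma> \<in> \<Sigma>" "\<Sum>S \<in> \<gamma>" for \<gamma>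
  proof -
    have "s \<in> \<gamma>" if s: "s \<in> S" for s
    proof (rule summand_mem[OF assms \<gamma>(1)])
      show "s \<in> \<omega>" using mem s .
      show "\<Sum>(S - {s}) \<in> \<omega>"
        using mem by (auto intro!: convex_cone_sum[OF convex_cone_mem[OF assms]])
      show "s + \<Sum>(S - {s}) \<in> \<gamma>" using \<gamma>(2) s S(1) by (simp add: sum.remove)
    qed
    then show ?thesis unfolding S(3) using \<gamma>(1) by (intro hull_minimal convex_cone_mem) auto
  qed
  ultimately show thesis using that by blast
qed

section \<open>Rays and their extremality\<close>

lemma ray_generator:
  assumes "\<rho> \<in> rays \<Sigma>"
  obtains u where "u \<noteq> 0" and "\<rho> = {c *\<^sub>R u | c. 0 \<le> c}"
proof -
  have \<rho>: "\<rho> \<in> \<Sigma>" "dim \<rho> = 1" using assms unfolding rays_def by auto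
  obtain S where S: "finite S" "independent S" "\<rho> = convex_cone hull S"
    using cone_generators[OF \<rho>(1)] .
  have "card S = 1" using \<rho>(2) S(2,3) by (simp add: dim_convex_cone_hull)
  then obtain u where u: "S = {u}" using card_1_singletonE by blast
  have "u \<noteq> 0" using S(2) u by (metis dependent_zero insertI1)
  then show thesis
    by (rule that) (simp add: S(3) u convex_cone_hull_singleton)
qed

lemma ray_subset:
  assumes "\<rho> \<in> rays \<Sigma>" and "\<gamma> \<in> \<Sigma>" and "x \<in> \<rho>" and "x \<in> \<gamma>" and "x \<noteq> 0"
  shows "\<rho> \<subseteq> \<gamma>"
proof -
  obtain u where u: "u \<noteq> 0" "\<rho> = {c *\<^sub>R u | c. 0 \<le> c}" using ray_generator[OF assms(1)] .
  obtain c where c: "x = c *\<^sub>R u" "0 \<le> c" using assms(3) u(2) by blast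
  with assms(5) have "0 < c" by (cases "c = 0") auto
  have "d *\<^sub>R u \<in> \<gamma>" if "0 \<le> d" for d
  proof -
    have "(d / c) *\<^sub>R x \<in> \<gamma>"
      using \<open>0 < c\<close> that assms(4) by (intro convex_cone_scaleR[OF convex_cone_mem[OF assms(2)]]) auto
    then show ?thesis using c \<open>0 < c\<close> by simp
  qed
  then show ?thesis using u(2) by blast
qed

lemma rays_subset_eq:
  assumes "\<rho> \<in> rays \<Sigma>" and "\<rho>' \<in> rays \<Sigma>" and "\<rho> \<subseteq> \<rho>'"
  shows "\<rho> = \<rho>'"
proof -
  obtain u where u: "u \<noteq> 0" "\<rho> = {c *\<^sub>R u | c. 0 \<le> c}" using ray_generator[OF assms(1)] .
  have "u \<in> \<rho>" using u(2) by (auto intro!: exI[of _ 1])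
  then have "\<rho>' \<subseteq> \<rho>"
    using ray_subset[OF assms(2), of \<rho> u] assms(1,3) u(1) unfolding rays_def by blast
  with assms(3) show ?thesis by blast
qed

text \<open>Split a generator of the ray along the two cones. By extremality both parts lie on the
  ray, and the nonzero one puts the whole ray into its cone.\<close>

lemma ray_subset_plus:
  assumes "\<rho> \<in> rays \<Sigma>" and "\<gamma> \<in> \<Sigma>" and "\<delta> \<in> \<Sigma>" and "\<gamma> + \<delta> \<in> \<Sigma>" and "\<rho> \<subseteq> \<gamma> + \<delta>"
  shows "\<rho> \<subseteq> \<gamma> \<or> \<rho> \<subseteq> \<delta>"
proof -
  obtain u where u: "u \<noteq> 0" "\<rho> = {c *\<^sub>R u | c. 0 \<le> c}" using ray_generator[OF assms(1)] .
  have "u \<in> \<rho>" using u(2) by (auto intro!: exI[of _ 1])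
  then obtain x y where xy: "x \<in> \<gamma>" "y \<in> \<delta>" "u = x + y"
    using assms(5) unfolding set_plus_def by blast
  have \<rho>: "\<rho> \<in> \<Sigma>" using assms(1) unfolding rays_def by auto
  have "x \<in> \<gamma> + \<delta>" "y \<in> \<gamma> + \<delta>"
    using xy convex_cone_subset_plus[OF convex_cone_mem convex_cone_mem] assms(2,3) by blast+
  then have "x \<in> \<rho>" "y \<in> \<rho>"
    using summand_mem[OF assms(4) \<rho>] xy(3) \<open>u \<in> \<rho>\<close> by (metis add.commute)+
  moreover have "x \<noteq> 0 \<or> y \<noteq> 0" using xy(3) u(1) by auto
  ultimately show ?thesis using ray_subset[OF assms(1)] xy assms(2,3) by blast
qed

lemma cone_generated_by_rays:
  assumes "\<gamma> \<in> \<Sigma>"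
  shows "\<gamma> = convex_cone hull (\<Union>{\<rho> \<in> rays \<Sigma>. \<rho> \<subseteq> \<gamma>})"
proof
  obtain S where S: "finite S" "independent S" "\<gamma> = convex_cone hull S"
    using cone_generators[OF assms] .
  have "s \<in> \<Union>{\<rho> \<in> rays \<Sigma>. \<rho> \<subseteq> \<gamma>}" if s: "s \<in> S" for s
  proof -
    have "convex_cone hull {s} \<in> \<Sigma>"
      using subset_generators_mem[OF S(2)] S(3) assms s by blast
    moreover have "dim (convex_cone hull {s}) = 1"
      using dim_convex_cone_hull[of "{s}"] independent_mono[OF S(2), of "{s}"] s by simp
    moreover have "convex_cone hull {s} \<subseteq> \<gamma>" using s S(3) by (simp add: hull_mono)
    moreover have "s \<in> convex_cone hull {s}" by (simp add: hull_inc)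
    ultimately show ?thesis unfolding rays_def by blast
  qed
  then have "S \<subseteq> \<Union>{\<rho> \<in> rays \<Sigma>. \<rho> \<subseteq> \<gamma>}" by blast
  then show "\<gamma> \<subseteq> convex_cone hull (\<Union>{\<rho> \<in> rays \<Sigma>. \<rho> \<subseteq> \<gamma>})"
    using hull_mono[of S] S(3) by blast
  show "convex_cone hull (\<Union>{\<rho> \<in> rays \<Sigma>. \<rho> \<subseteq> \<gamma>}) \<subseteq> \<gamma>"
    by (intro hull_minimal convex_cone_mem assms) blast
qed

section \<open>Lattice points and generators of quotient rays\<close>

lemma lattice_generators:
  assumes "\<gamma> \<in> \<Sigma>"
  shows "\<gamma> = convex_cone hull (lattice_N \<inter> \<gamma>)"
proof
  obtain G where G: "G \<subseteq> lattice_N" "\<gamma> = convex_cone hull G"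
    using fan assms unfolding fan_def rational_polyhedral_cone_def by blast
  then have "G \<subseteq> lattice_N \<inter> \<gamma>" by (simp add: hull_subset)
  then show "\<gamma> \<subseteq> convex_cone hull (lattice_N \<inter> \<gamma>)" using G(2) hull_mono by blast
  show "convex_cone hull (lattice_N \<inter> \<gamma>) \<subseteq> \<gamma>"
    by (intro hull_minimal convex_cone_mem assms) blast
qed

lemma span_lattice_points: "\<gamma> \<in> \<Sigma> \<Longrightarrow> span (lattice_N \<inter> \<gamma>) = span \<gamma>"
  using arg_cong[OF lattice_generators, of \<gamma> span] unfolding span_convex_cone_hull by simp

lemma zero_cone_mem: "{0} \<in> \<Sigma>"
proof -
  obtain \<gamma> where "\<gamma> \<in> \<Sigma>" using complete unfolding complete_fan_def by blast
  then obtain S where "independent S" "convex_cone hull S \<in> \<Sigma>" using cone_generators by metis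
  then show ?thesis using subset_generators_mem[of S "{}"] by simp
qed

lemma orbit_divisors_zero: "orbit_divisors \<Sigma> {0} = rays \<Sigma>"
  using zero_mem unfolding orbit_divisors_def rays_def by auto

lemma orbit_divisor_span:
  assumes "\<omega> \<in> \<Sigma>" and "\<tau> \<in> orbit_divisors \<Sigma> \<omega>" and "e \<in> span \<tau>" and "e \<notin> span \<omega>"
  shows "span \<tau> = span (insert e \<omega>)"
proof -
  have \<tau>: "\<omega> \<subseteq> \<tau>" "dim \<tau> = dim \<omega> + 1" using assms(2) unfolding orbit_divisors_def by auto
  have "insert e \<omega> \<subseteq> span \<tau>" using \<tau>(1) assms(3) span_superset by blast
  then have "span (insert e \<omega>) \<subseteq> span \<tau>" by (simp add: span_minimal)
  moreover have "dim (span \<tau>) \<le> dim (span (insert e \<omega>))"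
    using \<tau>(2) assms(4) by (simp add: dim_insert)
  ultimately show ?thesis by (metis subspace_dim_equal subspace_span)
qed

text \<open>The \<open>SOME\<close> in \<open>ray_gen\<close> is inhabited: a rational functional vanishing on \<open>\<omega>\<close> takes
  discrete values on the lattice, so a lattice point of least positive value generates.\<close>

lemma ray_gen_exists:
  assumes "\<omega> \<in> \<Sigma>" and "\<tau> \<in> orbit_divisors \<Sigma> \<omega>"
  shows "\<exists>u. u \<in> lattice_N \<and> quot_map \<omega> u \<in> quot_map \<omega> ` \<tau> \<and> u \<notin> span \<omega> \<and>
     (\<forall>v\<in>lattice_N. quot_map \<omega> v \<in> quot_map \<omega> ` \<tau> \<longrightarrow>
        (\<exists>k::nat. quot_map \<omega> v = quot_map \<omega> (real k *\<^sub>R u)))"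
proof -
  have \<tau>: "\<tau> \<in> \<Sigma>" "\<omega> \<subseteq> \<tau>" "dim \<tau> = dim \<omega> + 1"
    using assms(2) unfolding orbit_divisors_def by auto
  have "\<not> lattice_N \<inter> \<tau> \<subseteq> span \<omega>"
  proof
    assume "lattice_N \<inter> \<tau> \<subseteq> span \<omega>"
    then have "span \<tau> \<subseteq> span \<omega>" using span_lattice_points[OF \<tau>(1)] by (metis span_minimal subspace_span)
    then have "dim \<tau> \<le> dim \<omega>" by (metis dim_span dim_subset)
    then show False using \<tau>(3) by simp
  qed
  then obtain e where e: "e \<in> lattice_N" "e \<in> \<tau>" "e \<notin> span \<omega>" by blast
  have span_\<tau>: "span \<tau> = span (insert e \<omega>)"
    using orbit_divisor_span[OF assms _ e(3)] e(2) by (simp add: span_base)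
  \<comment> \<open>The image of \<open>\<tau>\<close> in the quotient is the ray through
    \<open>e\<close>, and \<open>c\<close> is the coordinate on it. If \<open>c\<close> were
    negative, then \<open>-c\<close> times \<open>e\<close> would be a summand, within
    \<open>\<tau>\<close>, of a vector \<open>x\<close> of \<open>\<omega>\<close>; extremality
    would put \<open>e\<close> into \<open>span \<omega>\<close>.\<close>
  have coord: "\<exists>c\<ge>0. v - c *\<^sub>R e \<in> span \<omega>" if v: "quot_map \<omega> v \<in> quot_map \<omega> ` \<tau>" for v
  proof -
    obtain t where t: "t \<in> \<tau>" "v - t \<in> span \<omega>" using v unfolding quot_map_image_iff by blast
    have "t \<in> span (insert e \<omega>)" using t(1) span_\<tau> span_base by blast
    then obtain c where c: "t - c *\<^sub>R e \<in> span \<omega>" unfolding span_insert by blast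
    have "0 \<le> c"
    proof (rule ccontr)
      assume "\<not> 0 \<le> c"
      obtain x y where xy: "x \<in> \<omega>" "y \<in> \<omega>" "t - c *\<^sub>R e = x - y"
        using span_convex_cone[OF convex_cone_mem[OF assms(1)] c] .
      have ce: "(- c) *\<^sub>R e \<in> \<tau>"
        using \<open>\<not> 0 \<le> c\<close> e(2) by (intro convex_cone_scaleR[OF convex_cone_mem[OF \<tau>(1)]]) auto
      moreover have "t + y \<in> \<tau>"
        using t(1) xy(2) \<tau>(2) by (intro convex_cone_add[OF convex_cone_mem[OF \<tau>(1)]]) auto
      moreover have "(- c) *\<^sub>R e + (t + y) \<in> \<omega>"
      proof -
        have "(- c) *\<^sub>R e + (t + y) = x" using xy(3) by (simp add: algebra_simps)
        then show ?thesis using xy(1) by simp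
      qed
      ultimately have "(- c) *\<^sub>R e \<in> span \<omega>"
        using summand_mem[OF \<tau>(1) assms(1)] span_base by blast
      then have "(- 1 / c) *\<^sub>R ((- c) *\<^sub>R e) \<in> span \<omega>" by (rule span_scale)
      then show False using \<open>\<not> 0 \<le> c\<close> e(3) by simp
    qed
    moreover have "v - c *\<^sub>R e \<in> span \<omega>" using span_add[OF t(2) c] by simp
    ultimately show ?thesis by blast
  qed
  have image: "quot_map \<omega> v \<in> quot_map \<omega> ` \<tau>" if "0 \<le> c" "v - c *\<^sub>R e \<in> span \<omega>" for c v
    using that e(2) convex_cone_scaleR[OF convex_cone_mem[OF \<tau>(1)]]
    unfolding quot_map_image_iff by blast
  have lat: "lattice_N \<subseteq> M_rat" by (rule lattice_N_subset_M_rat)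
  have "e \<notin> span (lattice_N \<inter> \<omega>)" using e(3) span_lattice_points[OF assms(1)] by simp
  then obtain a where a: "a \<in> M_rat" "\<And>s. s \<in> lattice_N \<inter> \<omega> \<Longrightarrow> a \<bullet> s = 0" "a \<bullet> e = 1"
    using rational_functional[of "lattice_N \<inter> \<omega>" e] lat e(1) by blast
  obtain N where N: "0 < N" "real N *\<^sub>R a \<in> lattice_N" using M_rat_denominator[OF a(1)] .
  \<comment> \<open>Clearing denominators makes \<open>b\<close> integral on the lattice. Its value
    on \<open>e\<close> is \<open>N\<close>, so \<open>e\<close> itself witnesses \<open>P N\<close>
    and a least positive value exists.\<close>
  define b where "b = real N *\<^sub>R a"
  have b_span: "b \<bullet> x = 0" if "x \<in> span \<omega>" for x
  proof -
    have "a \<bullet> x = 0"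
      using inner_span_eq_0[of "lattice_N \<inter> \<omega>" a x] a(2) that span_lattice_points[OF assms(1)] by simp
    then show ?thesis unfolding b_def by simp
  qed
  have b_e: "b \<bullet> v = c * N" if "v - c *\<^sub>R e \<in> span \<omega>" for v c
    using b_span[OF that] a(3) unfolding b_def by (simp add: inner_diff_right)
  define P where "P k \<longleftrightarrow> 0 < k \<and>
    (\<exists>v\<in>lattice_N. quot_map \<omega> v \<in> quot_map \<omega> ` \<tau> \<and> b \<bullet> v = real k)" for k :: nat
  have "P N"
    unfolding P_def using N(1) e(1) image[of 1 e] b_e[of e 1] span_zero by auto
  then obtain k where k: "P k" "\<And>j. j < k \<Longrightarrow> \<not> P j"
    using exists_least_iff[of P] by blast
  then obtain u where u: "u \<in> lattice_N" "quot_map \<omega> u \<in> quot_map \<omega> ` \<tau>" "b \<bullet> u = real k" "0 < k"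
    unfolding P_def by blast
  obtain d where d: "u - d *\<^sub>R e \<in> span \<omega>" using coord[OF u(2)] by blast
  have "u \<notin> span \<omega>" using b_span u(3,4) by force
  moreover have "\<exists>k::nat. quot_map \<omega> v = quot_map \<omega> (real k *\<^sub>R u)"
    if v: "v \<in> lattice_N" "quot_map \<omega> v \<in> quot_map \<omega> ` \<tau>" for v
  proof -
    obtain c where c: "0 \<le> c" "v - c *\<^sub>R e \<in> span \<omega>" using coord[OF v(2)] by blast
    have "b \<bullet> v \<in> \<int>" using Ints_inner N(2) v(1) unfolding b_def by blast
    then obtain i where i: "b \<bullet> v = of_int i" by (elim Ints_cases)
    have "0 \<le> i" using b_e[OF c(2)] c(1) i by (metis mult_nonneg_nonneg of_int_0_le_iff of_nat_0_le_iff)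
    then obtain j :: nat where j: "b \<bullet> v = real j" using i by (metis nonneg_int_cases of_int_of_nat_eq)
    \<comment> \<open>Division with remainder: \<open>v'\<close> is a lattice point with value
      \<open>j mod k\<close>. This value is nonnegative, so \<open>v'\<close> still maps into the
      ray, and minimality of \<open>k\<close> forces it to be 0.\<close>
    define q where "q = j div k"
    define v' where "v' = v - real q *\<^sub>R u"
    have v'_lat: "v' \<in> lattice_N"
      using v(1) u(1) unfolding v'_def lattice_N_def by simp
    have "v' - (c - q * d) *\<^sub>R e = (v - c *\<^sub>R e) - real q *\<^sub>R (u - d *\<^sub>R e)"
      unfolding v'_def by (simp add: algebra_simps)
    then have v'_span: "v' - (c - q * d) *\<^sub>R e \<in> span \<omega>"
      using span_diff[OF c(2) span_scale[OF d, of "real q"]] by simp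
    have "b \<bullet> v' = real j - real q * real k" unfolding v'_def by (simp add: inner_diff_right j u(3))
    also have "\<dots> = real (j mod k)"
      unfolding q_def by (metis add_diff_cancel_left' div_mult_mod_eq of_nat_add of_nat_mult)
    finally have bv': "b \<bullet> v' = real (j mod k)" .
    then have "(c - q * d) * N \<ge> 0" using b_e[OF v'_span] by simp
    then have "0 \<le> c - q * d" using N(1) by (simp add: zero_le_mult_iff)
    then have "quot_map \<omega> v' \<in> quot_map \<omega> ` \<tau>" using image v'_span by blast
    then have "P (j mod k)" if "0 < j mod k" using that v'_lat bv' unfolding P_def by blast
    then have "j mod k = 0" using k(2)[of "j mod k"] u(4) by fastforce
    then have "c - q * d = 0" using bv' b_e[OF v'_span] N(1) by simp
    then have "v' \<in> span \<omega>" using v'_span by simp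
    then show ?thesis unfolding v'_def quot_map_eq_iff by blast
  qed
  ultimately show ?thesis using u by blast
qed

lemma ray_gen:
  assumes "\<omega> \<in> \<Sigma>" and "\<tau> \<in> orbit_divisors \<Sigma> \<omega>"
  shows ray_gen_lattice: "ray_gen \<omega> \<tau> \<in> lattice_N"
    and ray_gen_notin_span: "ray_gen \<omega> \<tau> \<notin> span \<omega>"
    and ray_gen_in_span: "ray_gen \<omega> \<tau> \<in> span \<tau>"
    and ray_gen_image: "\<exists>t\<in>\<tau>. ray_gen \<omega> \<tau> - t \<in> span \<omega>"
proof -
  note g = someI_ex[OF ray_gen_exists[OF assms], folded ray_gen_def]
  show "ray_gen \<omega> \<tau> \<in> lattice_N" "ray_gen \<omega> \<tau> \<notin> span \<omega>" using g by blast+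
  show "\<exists>t\<in>\<tau>. ray_gen \<omega> \<tau> - t \<in> span \<omega>" using g quot_map_image_iff by blast
  then obtain t where "t \<in> \<tau>" "ray_gen \<omega> \<tau> - t \<in> span \<omega>" by blast
  moreover have "span \<omega> \<subseteq> span \<tau>" using assms(2) span_mono unfolding orbit_divisors_def by blast
  ultimately show "ray_gen \<omega> \<tau> \<in> span \<tau>"
    by (metis diff_add_cancel span_add span_base subsetD)
qed

lemma primitive_generator:
  assumes "\<rho> \<in> rays \<Sigma>"
  shows primitive_generator_mem: "ray_gen {0} \<rho> \<in> \<rho>"
    and primitive_generator_nonzero: "ray_gen {0} \<rho> \<noteq> 0"
    and primitive_generator_lattice: "ray_gen {0} \<rho> \<in> lattice_N"
    and ray_multiple: "x \<in> \<rho> \<Longrightarrow> \<exists>c. x = c *\<^sub>R ray_gen {0} \<rho>"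
proof -
  have \<rho>: "\<rho> \<in> orbit_divisors \<Sigma> {0}" using assms orbit_divisors_zero by simp
  show u: "ray_gen {0} \<rho> \<in> \<rho>" "ray_gen {0} \<rho> \<noteq> 0" "ray_gen {0} \<rho> \<in> lattice_N"
    using ray_gen[OF zero_cone_mem \<rho>] by auto
  obtain v where v: "v \<noteq> 0" "\<rho> = {c *\<^sub>R v | c. 0 \<le> c}" using ray_generator[OF assms] .
  obtain d where d: "ray_gen {0} \<rho> = d *\<^sub>R v" "0 \<le> d" using u(1) v(2) by blast
  with u(2) have "0 < d" by (cases "d = 0") auto
  show "\<exists>c. x = c *\<^sub>R ray_gen {0} \<rho>" if x: "x \<in> \<rho>"
  proof -
    obtain c where "x = c *\<^sub>R v" using x v(2) by blast
    then show ?thesis using d \<open>0 < d\<close> by (intro exI[of _ "c / d"]) auto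
  qed
qed

lemma inner_cone_eq_0:
  assumes "\<gamma> \<in> \<Sigma>" and "\<And>\<rho>. \<rho> \<in> rays \<Sigma> \<Longrightarrow> \<rho> \<subseteq> \<gamma> \<Longrightarrow> a \<bullet> ray_gen {0} \<rho> = 0" and "x \<in> span \<gamma>"
  shows "a \<bullet> x = 0"
proof (rule inner_span_eq_0)
  show "x \<in> span (\<Union>{\<rho> \<in> rays \<Sigma>. \<rho> \<subseteq> \<gamma>})"
    using assms(3) arg_cong[OF cone_generated_by_rays[OF assms(1)], of span]
    unfolding span_convex_cone_hull by blast
  fix s assume "s \<in> \<Union>{\<rho> \<in> rays \<Sigma>. \<rho> \<subseteq> \<gamma>}"
  then obtain \<rho> where \<rho>: "\<rho> \<in> rays \<Sigma>" "\<rho> \<subseteq> \<gamma>" "s \<in> \<rho>" by blast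
  obtain c where "s = c *\<^sub>R ray_gen {0} \<rho>" using ray_multiple[OF \<rho>(1,3)] by blast
  then show "a \<bullet> s = 0" using assms(2) \<rho> by simp
qed

section \<open>Cones around a given cone\<close>

text \<open>The points p + x/(n+1) tend to \<open>p\<close>. Finitely many closed cones cover them,
  so one cone contains infinitely many of them and hence also \<open>p\<close>, thus
  \<open>\<omega>\<close>. Scaling one of these points by n+1 gives the claim.\<close>

lemma star_absorbs:
  assumes "\<omega> \<in> \<Sigma>" and "\<And>\<gamma>. \<gamma> \<in> \<Sigma> \<Longrightarrow> p \<in> \<gamma> \<Longrightarrow> \<omega> \<subseteq> \<gamma>"
  obtains k \<gamma> where "0 \<le> k" and "\<gamma> \<in> \<Sigma>" and "\<omega> \<subseteq> \<gamma>" and "x + k *\<^sub>R p \<in> \<gamma>"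
proof -
  define f where "f n = p + (1 / real (Suc n)) *\<^sub>R x" for n
  have "\<exists>\<gamma>\<in>\<Sigma>. f n \<in> \<gamma>" for n using complete unfolding complete_fan_def by blast
  then obtain g where g: "\<And>n. g n \<in> \<Sigma>" "\<And>n. f n \<in> g n" by metis
  have "finite (range g)" using fan g(1) finite_subset[of "range g" \<Sigma>] unfolding fan_def by blast
  then obtain n where n: "infinite {m \<in> UNIV. g m = g n}"
    using pigeonhole_infinite[of "UNIV :: nat set" g] infinite_UNIV_nat by blast
  obtain r :: "nat \<Rightarrow> nat" where r: "strict_mono r" "\<And>i. g (r i) = g n"
    using infinite_enumerate[OF n] by blast
  have "f \<longlonglongrightarrow> p + 0 *\<^sub>R x"
    unfolding f_def by (intro tendsto_intros LIMSEQ_inverse_real_of_nat[unfolded inverse_eq_divide])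
  then have "(f \<circ> r) \<longlonglongrightarrow> p" using LIMSEQ_subseq_LIMSEQ[OF _ r(1)] by simp
  moreover have "(f \<circ> r) i \<in> g n" for i using g(2)[of "r i"] r(2) by simp
  ultimately have "p \<in> g n" using closed_sequentially[OF closed_mem[OF g(1)]] by blast
  then have "\<omega> \<subseteq> g n" using assms(2) g(1) by blast
  moreover have "real (Suc n) *\<^sub>R f n \<in> g n"
    by (intro convex_cone_scaleR[OF convex_cone_mem[OF g(1)]] g(2)) simp
  then have "x + real (Suc n) *\<^sub>R p \<in> g n"
    unfolding f_def by (simp add: scaleR_add_right add.commute del: of_nat_Suc)
  ultimately show thesis using that[of "real (Suc n)" "g n"] g(1) by simp
qed

text \<open>Completeness at the level of the quotient: modulo \<open>span \<omega>\<close>, every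
  vector is a link vector plus a multiple, possibly negative, of the generator of
  \<open>\<alpha>\<close>. A link normal reads this multiple off as its value at
  \<open>x\<close>.\<close>

lemma link_covers:
  assumes "\<alpha> \<in> rays \<Sigma>" and "\<omega> \<in> \<Sigma>" and "\<alpha> + \<omega> \<in> \<Sigma>"
  obtains \<tau> l s s' c where "\<tau> \<in> link \<Sigma> (\<alpha> + \<omega>)" and "l \<in> \<tau>" and "s \<in> \<omega>" and "s' \<in> \<omega>"
    and "x + s = l + s' + c *\<^sub>R ray_gen {0} \<alpha>"
proof -
  obtain p where p: "p \<in> \<alpha> + \<omega>" "\<And>\<gamma>. \<gamma> \<in> \<Sigma> \<Longrightarrow> p \<in> \<gamma> \<Longrightarrow> \<alpha> + \<omega> \<subseteq> \<gamma>"
    using relative_interior_point[OF assms(3)] by blast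
  obtain k \<gamma> where k: "0 \<le> k" "\<gamma> \<in> \<Sigma>" "\<alpha> + \<omega> \<subseteq> \<gamma>" "x + k *\<^sub>R p \<in> \<gamma>"
    using star_absorbs[OF assms(3) p(2)] by blast
  obtain \<tau> where \<tau>: "\<tau> \<in> link \<Sigma> (\<alpha> + \<omega>)" "\<gamma> = \<tau> + (\<alpha> + \<omega>)"
    using link_decomposition[OF k(2) assms(3) k(3)] .
  have dec: "\<exists>c s. s \<in> \<omega> \<and> y = c *\<^sub>R ray_gen {0} \<alpha> + s" if y: "y \<in> \<alpha> + \<omega>" for y
  proof -
    obtain v s where "y = v + s" "v \<in> \<alpha>" "s \<in> \<omega>" using y by (rule set_plus_elim)
    then show ?thesis using ray_multiple[OF assms(1)] by blast
  qed
  obtain d s where s: "s \<in> \<omega>" "p = d *\<^sub>R ray_gen {0} \<alpha> + s" using dec p(1) by blast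
  obtain l y where "l \<in> \<tau>" "y \<in> \<alpha> + \<omega>" "x + k *\<^sub>R p = l + y"
    using k(4) unfolding \<tau>(2) set_plus_def[of \<tau>] by blast
  moreover obtain c s' where "s' \<in> \<omega>" "y = c *\<^sub>R ray_gen {0} \<alpha> + s'" using dec \<open>y \<in> \<alpha> + \<omega>\<close> by blast
  moreover have "k *\<^sub>R s \<in> \<omega>"
    using k(1) s(1) by (intro convex_cone_scaleR[OF convex_cone_mem[OF assms(2)]])
  \<comment> \<open>The push \<open>k\<close> times \<open>p\<close> has an
    \<open>\<alpha>\<close>-part with coefficient \<open>k * d\<close>; it moves to the right-hand
    side, and only the part in \<open>\<omega>\<close> stays on the left.\<close>
  moreover have "x + k *\<^sub>R s = l + s' + (c - k * d) *\<^sub>R ray_gen {0} \<alpha>"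
    using calculation(3,5) s(2) by (simp add: algebra_simps)
  ultimately show thesis using that \<tau>(1) by blast
qed

text \<open>If the generator were \<open>x - y\<close> with \<open>x\<close>, \<open>y\<close> in
  \<open>\<omega>\<close>, then it would be a summand of \<open>x\<close> inside
  \<open>\<rho> + \<omega>\<close>, and extremality would place the ray in
  \<open>\<omega>\<close>.\<close>

lemma primitive_generator_notin_span:
  assumes "\<rho> \<in> rays \<Sigma>" and "\<omega> \<in> \<Sigma>" and "\<rho> + \<omega> \<in> \<Sigma>" and "\<not> \<rho> \<subseteq> \<omega>"
  shows "ray_gen {0} \<rho> \<notin> span \<omega>"
proof
  assume "ray_gen {0} \<rho> \<in> span \<omega>"
  then obtain x y where xy: "x \<in> \<omega>" "y \<in> \<omega>" "ray_gen {0} \<rho> = x - y"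
    using span_convex_cone[OF convex_cone_mem[OF assms(2)]] by blast
  have \<rho>: "\<rho> \<in> \<Sigma>" using assms(1) unfolding rays_def by blast
  have "ray_gen {0} \<rho> \<in> \<rho> + \<omega>" "y \<in> \<rho> + \<omega>"
    using convex_cone_subset_plus[OF convex_cone_mem[OF \<rho>] convex_cone_mem[OF assms(2)]]
      primitive_generator_mem[OF assms(1)] xy(2) by blast+
  moreover have "ray_gen {0} \<rho> + y \<in> \<omega>" using xy by simp
  ultimately have "ray_gen {0} \<rho> \<in> \<omega>" using summand_mem[OF assms(3,2)] by blast
  then show False
    using ray_subset[OF assms(1,2)] primitive_generator_mem[OF assms(1)]
      primitive_generator_nonzero[OF assms(1)] assms(4) by blast
qed

lemma plus_ray_orbit_divisor:
  assumes "\<rho> \<in> rays \<Sigma>" and "\<omega> \<in> \<Sigma>" and "\<rho> + \<omega> \<in> \<Sigma>" and "\<not> \<rho> \<subseteq> \<omega>"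
  shows "\<rho> + \<omega> \<in> orbit_divisors \<Sigma> \<omega>"
proof -
  let ?u = "ray_gen {0} \<rho>"
  have \<rho>: "\<rho> \<in> \<Sigma>" using assms(1) unfolding rays_def by blast
  note sub = convex_cone_subset_plus[OF convex_cone_mem[OF \<rho>] convex_cone_mem[OF assms(2)]]
  have "insert ?u \<omega> \<subseteq> \<rho> + \<omega>" using sub primitive_generator_mem[OF assms(1)] by blast
  moreover have "\<rho> + \<omega> \<subseteq> span (insert ?u \<omega>)"
  proof
    fix x assume "x \<in> \<rho> + \<omega>"
    then obtain v w where x: "x = v + w" "v \<in> \<rho>" "w \<in> \<omega>" by (rule set_plus_elim)
    then obtain c where "v = c *\<^sub>R ?u" using ray_multiple[OF assms(1)] by blast
    then have "v \<in> span (insert ?u \<omega>)" by (simp add: span_scale span_base)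
    moreover have "w \<in> span (insert ?u \<omega>)" using x(3) by (simp add: span_base)
    ultimately show "x \<in> span (insert ?u \<omega>)" unfolding x(1) by (rule span_add)
  qed
  ultimately have "span (\<rho> + \<omega>) = span (insert ?u \<omega>)"
    by (metis span_minimal span_mono subset_antisym subspace_span)
  then have "dim (\<rho> + \<omega>) = dim (insert ?u \<omega>)" by (metis dim_span)
  also have "\<dots> = dim \<omega> + 1"
    using primitive_generator_notin_span[OF assms] by (simp add: dim_insert)
  finally show ?thesis unfolding orbit_divisors_def using assms(3) sub by blast
qed

text \<open>Modulo \<open>span \<omega>\<close>, \<open>\<tau>\<close> is one-dimensional and
  spanned by \<open>ray_gen \<omega> \<tau>\<close>, so one coefficient of a divisor on the orbit
  closure controls the functional on all of \<open>\<tau>\<close>.\<close>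

lemma inner_orbit_divisor_eq_0:
  assumes "\<omega> \<in> \<Sigma>" and "\<tau> \<in> orbit_divisors \<Sigma> \<omega>" and "\<And>x. x \<in> \<omega> \<Longrightarrow> a \<bullet> x = 0"
    and "a \<bullet> ray_gen \<omega> \<tau> = 0" and "x \<in> \<tau>"
  shows "a \<bullet> x = 0"
proof (rule inner_span_eq_0)
  show "x \<in> span (insert (ray_gen \<omega> \<tau>) \<omega>)"
    using orbit_divisor_span[OF assms(1,2) ray_gen_in_span[OF assms(1,2)]
        ray_gen_notin_span[OF assms(1,2)]] assms(5) span_base by blast
qed (use assms(3,4) in auto)

subsection \<open>Restriction to zero as a condition on the link\<close>

lemma char_divisor_rat:
  assumes "\<omega> \<in> \<Sigma>" and "m \<in> M_rat"
  shows "char_divisor \<Sigma> \<omega> m \<in> rat_divisors \<Sigma> \<omega>"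
  using ray_gen_lattice[OF assms(1)] lattice_N_subset_M_rat Rats_inner[OF assms(2)]
  unfolding rat_divisors_def char_divisor_def by auto

text \<open>Such an \<open>a\<close> is a character whose divisor agrees with D_\<alpha> on all rays
  of the star of \<open>\<alpha> + \<omega>\<close>. The value 1 gives the coefficient of
  D_\<alpha>, and its sign selects the side of the hyperplane on which \<open>\<alpha>\<close>
  lies.\<close>

definition link_normal :: "(real ^ 'n) set \<Rightarrow> (real ^ 'n) set \<Rightarrow> real ^ 'n \<Rightarrow> bool" where
  "link_normal \<alpha> \<omega> a \<longleftrightarrow> a \<in> M_rat \<and> a \<bullet> ray_gen {0} \<alpha> = 1 \<and> (\<forall>x\<in>\<omega>. a \<bullet> x = 0) \<and>
     (\<forall>\<tau>\<in>link \<Sigma> (\<alpha> + \<omega>). \<forall>x\<in>\<tau>. a \<bullet> x = 0)"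

text \<open>A ray of \<open>\<tau> = \<kappa> + (\<alpha> + \<omega>)\<close> lies in
  \<open>\<kappa>\<close>, \<open>\<alpha>\<close> or \<open>\<omega>\<close>, and \<open>a\<close>
  vanishes on the first and the last.\<close>

lemma link_normal_ray:
  assumes "\<alpha> \<in> rays \<Sigma>" and "\<omega> \<in> \<Sigma>" and "\<alpha> + \<omega> \<in> \<Sigma>"
    and "link_normal \<alpha> \<omega> a" and "\<tau> \<in> \<Sigma>" and "\<alpha> + \<omega> \<subseteq> \<tau>"
    and "\<rho> \<in> rays \<Sigma>" and "\<rho> \<subseteq> \<tau>"
  shows "a \<bullet> ray_gen {0} \<rho> = prime_divisor \<alpha> \<rho>"
proof (cases "\<rho> = \<alpha>")
  case True
  then show ?thesis using assms(4) unfolding link_normal_def prime_divisor_def by simp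
next
  case False
  obtain \<kappa> where \<kappa>: "\<kappa> \<in> link \<Sigma> (\<alpha> + \<omega>)" "\<tau> = \<kappa> + (\<alpha> + \<omega>)"
    using link_decomposition[OF assms(5,3,6)] .
  have "\<kappa> \<in> \<Sigma>" using \<kappa>(1) unfolding link_def by blast
  have \<alpha>: "\<alpha> \<in> \<Sigma>" using assms(1) unfolding rays_def by blast
  have "\<not> \<rho> \<subseteq> \<alpha>" using False rays_subset_eq[OF assms(7,1)] by blast
  moreover have "\<rho> \<subseteq> \<kappa> \<or> \<rho> \<subseteq> \<alpha> + \<omega>"
    using ray_subset_plus[OF assms(7) \<open>\<kappa> \<in> \<Sigma>\<close> assms(3)] \<kappa>(2) assms(5,8) by blast
  moreover have "\<rho> \<subseteq> \<alpha> \<or> \<rho> \<subseteq> \<omega>" if "\<rho> \<subseteq> \<alpha> + \<omega>"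
    using ray_subset_plus[OF assms(7) \<alpha> assms(2,3) that] .
  ultimately have "\<rho> \<subseteq> \<kappa> \<or> \<rho> \<subseteq> \<omega>" by blast
  then have "a \<bullet> ray_gen {0} \<rho> = 0"
    using assms(4) \<kappa>(1) primitive_generator_mem[OF assms(7)] unfolding link_normal_def by blast
  then show ?thesis using False by (simp add: prime_divisor_def)
qed

text \<open>The witness is \<open>m + m'\<close>: \<open>m\<close> moves -D_\<alpha> to a divisor
  \<open>D\<close> whose components do not contain the orbit closure, and \<open>m'\<close>
  trivialises the restriction \<open>E\<close> of \<open>D\<close>.\<close>

lemma restricts_to_zero_imp_link_normal:
  assumes "\<alpha> \<in> rays \<Sigma>" and "\<omega> \<in> \<Sigma>" and "\<not> \<alpha> \<subseteq> \<omega>" and "\<alpha> + \<omega> \<in> \<Sigma>"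
    and "restricts_to_zero \<Sigma> (- prime_divisor \<alpha>) (\<alpha> + \<omega>)"
  shows "\<exists>a. link_normal \<alpha> \<omega> a"
proof -
  let ?\<Omega> = "\<alpha> + \<omega>"
  have \<alpha>: "\<alpha> \<in> \<Sigma>" using assms(1) unfolding rays_def by blast
  note sub = convex_cone_subset_plus[OF convex_cone_mem[OF \<alpha>] convex_cone_mem[OF assms(2)]]
  \<comment> \<open>The equality of classes is exploited through a single member, the zero divisor,
    which must then arise by moving and restricting.\<close>
  have "(\<lambda>_. 0) \<in> divisor_class \<Sigma> ?\<Omega> (\<lambda>_. 0)"
    unfolding divisor_class_def using lin_equiv_zero_refl by blast
  then have "(\<lambda>_. 0) \<in> restricted_class \<Sigma> ?\<Omega> (- prime_divisor \<alpha>)"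
    using assms(5) unfolding restricts_to_zero_def by simp
  then obtain D E where D: "lin_equiv \<Sigma> {0} D (- prime_divisor \<alpha>)"
    and E: "divisor_restriction \<Sigma> ?\<Omega> D E" and E0: "lin_equiv \<Sigma> ?\<Omega> (\<lambda>_. 0) E"
    unfolding restricted_class_def by blast
  obtain m where m: "m \<in> M_rat" "D - (- prime_divisor \<alpha>) = char_divisor \<Sigma> {0} m"
    using D unfolding lin_equiv_def by blast
  have D_ray: "D \<rho> = m \<bullet> ray_gen {0} \<rho> - prime_divisor \<alpha> \<rho>" if "\<rho> \<in> rays \<Sigma>" for \<rho>
    using fun_cong[OF m(2), of \<rho>] that by (simp add: char_divisor_def orbit_divisors_zero)
  obtain m' where m': "m' \<in> M_rat" "\<forall>x\<in>?\<Omega>. m' \<bullet> x = 0" "(\<lambda>_. 0) - E = char_divisor \<Sigma> ?\<Omega> m'"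
    using E0 unfolding lin_equiv_def by blast
  have E_val: "E \<tau> = - (m' \<bullet> ray_gen ?\<Omega> \<tau>)" if "\<tau> \<in> orbit_divisors \<Sigma> ?\<Omega>" for \<tau>
    using fun_cong[OF m'(3), of \<tau>] that by (simp add: char_divisor_def)
  have D_\<Omega>: "D \<rho> = 0" if "\<rho> \<in> rays \<Sigma>" "\<rho> \<subseteq> ?\<Omega>" for \<rho>
    using E that unfolding divisor_restriction_def by blast
  have m'_\<Omega>: "m' \<bullet> ray_gen {0} \<rho> = 0" if "\<rho> \<in> rays \<Sigma>" "\<rho> \<subseteq> ?\<Omega>" for \<rho>
    using m'(2) that primitive_generator_mem by blast
  have in_\<Omega>: "(m + m') \<bullet> ray_gen {0} \<rho> = prime_divisor \<alpha> \<rho>" if "\<rho> \<in> rays \<Sigma>" "\<rho> \<subseteq> ?\<Omega>" for \<rho>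
    using D_ray[OF that(1)] D_\<Omega>[OF that] m'_\<Omega>[OF that] by (simp add: inner_add_left)
  have near: "(m + m') \<bullet> ray_gen {0} \<rho> = prime_divisor \<alpha> \<rho>"
    if \<tau>: "\<tau> \<in> orbit_divisors \<Sigma> ?\<Omega>" and \<rho>: "\<rho> \<in> rays \<Sigma>" "\<rho> \<subseteq> \<tau>" for \<tau> \<rho>
  proof -
    obtain n where n: "\<And>\<rho>. \<rho> \<in> rays \<Sigma> \<Longrightarrow> \<rho> \<subseteq> \<tau> \<Longrightarrow> D \<rho> = n \<bullet> ray_gen {0} \<rho>"
      "E \<tau> = n \<bullet> ray_gen ?\<Omega> \<tau>"
      using divisor_restriction_local_equation[OF E \<tau>] by blast
    have "?\<Omega> \<subseteq> \<tau>" using \<tau> unfolding orbit_divisors_def by blast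
    \<comment> \<open>The local equation \<open>n\<close> and \<open>-m'\<close> both vanish on
      \<open>?\<Omega>\<close> and give the same coefficient of \<open>E\<close> at
      \<open>\<tau>\<close>. Hence they agree on \<open>\<tau>\<close>, and \<open>D\<close> has
      coefficient \<open>-m'\<close> paired with the generator at every ray of
      \<open>\<tau>\<close>.\<close>
    have n0: "(n + m') \<bullet> x = 0" if x: "x \<in> ?\<Omega>" for x
    proof (rule inner_cone_eq_0[OF assms(4) _ span_base[OF x]])
      fix \<rho> assume \<rho>: "\<rho> \<in> rays \<Sigma>" "\<rho> \<subseteq> ?\<Omega>"
      then have "n \<bullet> ray_gen {0} \<rho> = 0" using n(1) D_\<Omega> \<open>?\<Omega> \<subseteq> \<tau>\<close> by (metis subset_trans)
      then show "(n + m') \<bullet> ray_gen {0} \<rho> = 0" using m'_\<Omega>[OF \<rho>] by (simp add: inner_add_left)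
    qed
    have "(n + m') \<bullet> ray_gen ?\<Omega> \<tau> = 0"
      using n(2) E_val[OF \<tau>] by (simp add: inner_add_left)
    then have "(n + m') \<bullet> ray_gen {0} \<rho> = 0"
      using inner_orbit_divisor_eq_0[OF assms(4) \<tau> n0] \<rho>(2) primitive_generator_mem[OF \<rho>(1)] by blast
    then show ?thesis using n(1)[OF \<rho>] D_ray[OF \<rho>(1)] by (simp add: inner_add_left)
  qed
  have "(m + m') \<bullet> ray_gen {0} \<alpha> = 1"
    using in_\<Omega>[OF assms(1) sub(1)] by (simp add: prime_divisor_def)
  moreover have "(m + m') \<bullet> x = 0" if x: "x \<in> \<omega>" for x
  proof (rule inner_cone_eq_0[OF assms(2) _ span_base[OF x]])
    fix \<rho> assume \<rho>: "\<rho> \<in> rays \<Sigma>" "\<rho> \<subseteq> \<omega>"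
    then have "\<rho> \<noteq> \<alpha>" using assms(3) by blast
    moreover have "(m + m') \<bullet> ray_gen {0} \<rho> = prime_divisor \<alpha> \<rho>"
      using in_\<Omega> \<rho> sub(2) by blast
    ultimately show "(m + m') \<bullet> ray_gen {0} \<rho> = 0" by (simp add: prime_divisor_def)
  qed
  moreover have "(m + m') \<bullet> x = 0" if \<tau>: "\<tau> \<in> link \<Sigma> ?\<Omega>" and x: "x \<in> \<tau>" for \<tau> x
  proof -
    have \<tau>': "\<tau> \<in> \<Sigma>" "\<tau> \<inter> ?\<Omega> = {0}" "\<tau> + ?\<Omega> \<in> \<Sigma>" using \<tau> unfolding link_def by blast+
    note sub' = convex_cone_subset_plus[OF convex_cone_mem[OF \<tau>'(1)] convex_cone_mem[OF assms(4)]]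
    show ?thesis
    proof (rule inner_cone_eq_0[OF \<tau>'(1) _ span_base[OF x]])
      fix \<rho> assume \<rho>: "\<rho> \<in> rays \<Sigma>" "\<rho> \<subseteq> \<tau>"
      have \<rho>': "\<rho> \<in> \<Sigma>" using \<rho>(1) unfolding rays_def by blast
      have not: "\<not> \<rho> \<subseteq> ?\<Omega>"
        using \<rho>(2) \<tau>'(2) primitive_generator_mem[OF \<rho>(1)] primitive_generator_nonzero[OF \<rho>(1)]
        by blast
      \<comment> \<open>\<open>near\<close> sees only cones of one dimension more than
        \<open>?\<Omega>\<close>; every ray of the link spans such a cone with
        \<open>?\<Omega>\<close>.\<close>
      have "\<rho> + ?\<Omega> \<in> \<Sigma>" using plus_mem[OF \<tau>'(3) \<rho>' assms(4)] \<rho>(2) sub' by blast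
      then have "\<rho> + ?\<Omega> \<in> orbit_divisors \<Sigma> ?\<Omega>"
        using plus_ray_orbit_divisor[OF \<rho>(1) assms(4)] not by blast
      then have "(m + m') \<bullet> ray_gen {0} \<rho> = prime_divisor \<alpha> \<rho>"
        using near \<rho>(1) convex_cone_subset_plus[OF convex_cone_mem[OF \<rho>'] convex_cone_mem[OF assms(4)]]
        by blast
      moreover have "\<rho> \<noteq> \<alpha>" using not sub(1) by blast
      ultimately show "(m + m') \<bullet> ray_gen {0} \<rho> = 0" by (simp add: prime_divisor_def)
    qed
  qed
  ultimately have "link_normal \<alpha> \<omega> (m + m')"
    unfolding link_normal_def using M_rat_add[OF m(1) m'(1)] by blast
  then show ?thesis by blast
qed

text \<open>Near the orbit closure D_\<alpha> is the divisor of \<open>a\<close>. So any admissible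
  move of -D_\<alpha> by \<open>m\<close> restricts to the divisor of the character
  \<open>m - a\<close>, and the move by \<open>a\<close> itself restricts to zero. These are the two
  inclusions.\<close>

lemma link_normal_imp_restricts_to_zero:
  assumes "\<alpha> \<in> rays \<Sigma>" and "\<omega> \<in> \<Sigma>" and "\<not> \<alpha> \<subseteq> \<omega>" and "\<alpha> + \<omega> \<in> \<Sigma>"
    and "link_normal \<alpha> \<omega> a"
  shows "restricts_to_zero \<Sigma> (- prime_divisor \<alpha>) (\<alpha> + \<omega>)"
  unfolding restricts_to_zero_def
proof
  let ?\<Omega> = "\<alpha> + \<omega>"
  have a: "a \<in> M_rat" using assms(5) unfolding link_normal_def by blast
  note a_ray = link_normal_ray[OF assms(1,2,4,5)]
  show "restricted_class \<Sigma> ?\<Omega> (- prime_divisor \<alpha>) \<subseteq> divisor_class \<Sigma> ?\<Omega> (\<lambda>_. 0)"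
  proof
    fix F assume "F \<in> restricted_class \<Sigma> ?\<Omega> (- prime_divisor \<alpha>)"
    then obtain D E where D: "lin_equiv \<Sigma> {0} D (- prime_divisor \<alpha>)"
      and E: "divisor_restriction \<Sigma> ?\<Omega> D E" and FE: "lin_equiv \<Sigma> ?\<Omega> F E"
      unfolding restricted_class_def by blast
    obtain m where m: "m \<in> M_rat" "D - (- prime_divisor \<alpha>) = char_divisor \<Sigma> {0} m"
      using D unfolding lin_equiv_def by blast
    have D_ray: "D \<rho> = m \<bullet> ray_gen {0} \<rho> - prime_divisor \<alpha> \<rho>" if "\<rho> \<in> rays \<Sigma>" for \<rho>
      using fun_cong[OF m(2), of \<rho>] that by (simp add: char_divisor_def orbit_divisors_zero)
    have E_rat: "E \<in> rat_divisors \<Sigma> ?\<Omega>" using E unfolding divisor_restriction_def by blast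
    have ma: "(m - a) \<bullet> x = 0" if x: "x \<in> ?\<Omega>" for x
    proof (rule inner_cone_eq_0[OF assms(4) _ span_base[OF x]])
      fix \<rho> assume \<rho>: "\<rho> \<in> rays \<Sigma>" "\<rho> \<subseteq> ?\<Omega>"
      have "D \<rho> = 0" using E \<rho> unfolding divisor_restriction_def by blast
      then show "(m - a) \<bullet> ray_gen {0} \<rho> = 0"
        using D_ray[OF \<rho>(1)] a_ray[OF assms(4) subset_refl \<rho>] by (simp add: inner_diff_left)
    qed
    have E_val: "E \<tau> = (m - a) \<bullet> ray_gen ?\<Omega> \<tau>" if \<tau>: "\<tau> \<in> orbit_divisors \<Sigma> ?\<Omega>" for \<tau>
    proof -
      have \<tau>': "\<tau> \<in> \<Sigma>" "?\<Omega> \<subseteq> \<tau>" using \<tau> unfolding orbit_divisors_def by blast+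
      obtain n where n: "\<And>\<rho>. \<rho> \<in> rays \<Sigma> \<Longrightarrow> \<rho> \<subseteq> \<tau> \<Longrightarrow> D \<rho> = n \<bullet> ray_gen {0} \<rho>"
        "E \<tau> = n \<bullet> ray_gen ?\<Omega> \<tau>"
        using divisor_restriction_local_equation[OF E \<tau>] by blast
      \<comment> \<open>\<open>m - a\<close> is a local equation of \<open>D\<close> on every chart
        of the star: it has the same values as \<open>n\<close> on the rays of
        \<open>\<tau>\<close>, hence on the span of \<open>\<tau>\<close>, where
        \<open>ray_gen\<close> lies.\<close>
      have "(n - (m - a)) \<bullet> ray_gen ?\<Omega> \<tau> = 0"
      proof (rule inner_cone_eq_0[OF \<tau>'(1) _ ray_gen_in_span[OF assms(4) \<tau>]])
        fix \<rho> assume \<rho>: "\<rho> \<in> rays \<Sigma>" "\<rho> \<subseteq> \<tau>"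
        then show "(n - (m - a)) \<bullet> ray_gen {0} \<rho> = 0"
          using D_ray[OF \<rho>(1)] a_ray[OF \<tau>' \<rho>] n(1)[OF \<rho>] by (simp add: inner_diff_left)
      qed
      then show ?thesis using n(2) by (simp add: inner_diff_left)
    qed
    have "E - (\<lambda>_. 0) = char_divisor \<Sigma> ?\<Omega> (m - a)"
      using E_val E_rat by (auto simp: char_divisor_def rat_divisors_def)
    then have "lin_equiv \<Sigma> ?\<Omega> E (\<lambda>_. 0)"
      unfolding lin_equiv_def using E_rat zero_rat_divisor ma M_rat_diff[OF m(1) a] by blast
    then show "F \<in> divisor_class \<Sigma> ?\<Omega> (\<lambda>_. 0)"
      unfolding divisor_class_def using lin_equiv_trans[OF FE] by blast
  qed
  show "divisor_class \<Sigma> ?\<Omega> (\<lambda>_. 0) \<subseteq> restricted_class \<Sigma> ?\<Omega> (- prime_divisor \<alpha>)"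
  proof
    fix F assume "F \<in> divisor_class \<Sigma> ?\<Omega> (\<lambda>_. 0)"
    then have F: "lin_equiv \<Sigma> ?\<Omega> F (\<lambda>_. 0)" unfolding divisor_class_def by blast
    define D where "D = char_divisor \<Sigma> {0} a - prime_divisor \<alpha>"
    have neg_rat: "- prime_divisor \<alpha> \<in> rat_divisors \<Sigma> {0}"
      using assms(1) unfolding rat_divisors_def orbit_divisors_zero prime_divisor_def by auto
    have char_rat: "char_divisor \<Sigma> {0} a \<in> rat_divisors \<Sigma> {0}"
      using char_divisor_rat[OF zero_cone_mem a] .
    have D_rat: "D \<in> rat_divisors \<Sigma> {0}"
      using neg_rat char_rat unfolding D_def rat_divisors_def by auto
    have "D - (- prime_divisor \<alpha>) = char_divisor \<Sigma> {0} a"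
      unfolding D_def by (simp add: fun_eq_iff)
    then have "lin_equiv \<Sigma> {0} D (- prime_divisor \<alpha>)"
      unfolding lin_equiv_def using D_rat neg_rat a by auto
    \<comment> \<open>All coefficients of \<open>D\<close> on the star vanish, so the zero character
      is a local equation on each chart.\<close>
    moreover have D0: "D \<rho> = 0" if "\<tau> \<in> \<Sigma>" "?\<Omega> \<subseteq> \<tau>" "\<rho> \<in> rays \<Sigma>" "\<rho> \<subseteq> \<tau>" for \<tau> \<rho>
      using a_ray[OF that] that(3) unfolding D_def
      by (simp add: char_divisor_def orbit_divisors_zero)
    have "divisor_restriction \<Sigma> ?\<Omega> D (\<lambda>_. 0)"
      unfolding divisor_restriction_def
    proof (intro conjI ballI impI)
      show "D \<in> rat_divisors \<Sigma> {0}" by (rule D_rat)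
      show "(\<lambda>_. 0) \<in> rat_divisors \<Sigma> ?\<Omega>" by (rule zero_rat_divisor)
      show "D \<rho> = 0" if "\<rho> \<in> rays \<Sigma>" "\<rho> \<subseteq> ?\<Omega>" for \<rho>
        using D0[OF assms(4)] that by blast
      show "\<exists>m\<in>M_rat. (\<forall>\<rho>\<in>rays \<Sigma>. \<rho> \<subseteq> \<tau> \<longrightarrow> D \<rho> = m \<bullet> ray_gen {0} \<rho>) \<and>
          0 = m \<bullet> ray_gen ?\<Omega> \<tau>" if "\<tau> \<in> orbit_divisors \<Sigma> ?\<Omega>" for \<tau>
        using D0[of \<tau>] that M_rat_zero unfolding orbit_divisors_def
        by (intro bexI[of _ 0]) auto
    qed
    ultimately show "F \<in> restricted_class \<Sigma> ?\<Omega> (- prime_divisor \<alpha>)"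
      unfolding restricted_class_def using F by blast
  qed
qed

subsection \<open>Supports of links\<close>

text \<open>For \<open>x\<close> in the hyperplane, the coefficient \<open>c\<close> provided by
  \<open>link_covers\<close> equals \<open>a \<bullet> x\<close>, that is 0, so \<open>x\<close> is
  congruent to a link vector.\<close>

lemma quot_support_link:
  assumes "\<alpha> \<in> rays \<Sigma>" and "\<omega> \<in> \<Sigma>" and "\<alpha> + \<omega> \<in> \<Sigma>" and "link_normal \<alpha> \<omega> a"
  shows "quot_support \<omega> (link \<Sigma> (\<alpha> + \<omega>)) = quot_map \<omega> ` {x. a \<bullet> x = 0}"
proof
  show "quot_support \<omega> (link \<Sigma> (\<alpha> + \<omega>)) \<subseteq> quot_map \<omega> ` {x. a \<bullet> x = 0}"
    using assms(4) unfolding quot_support_def link_normal_def by blast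
  show "quot_map \<omega> ` {x. a \<bullet> x = 0} \<subseteq> quot_support \<omega> (link \<Sigma> (\<alpha> + \<omega>))"
  proof (rule image_subsetI)
    fix x assume "x \<in> {x. a \<bullet> x = 0}"
    then have ax: "a \<bullet> x = 0" by simp
    obtain \<tau> l s s' c where l: "\<tau> \<in> link \<Sigma> (\<alpha> + \<omega>)" "l \<in> \<tau>" "s \<in> \<omega>" "s' \<in> \<omega>"
      "x + s = l + s' + c *\<^sub>R ray_gen {0} \<alpha>"
      using link_covers[OF assms(1-3)] .
    have "a \<bullet> (x + s) = c"
      using assms(4) l(1,2,4) unfolding l(5) link_normal_def by (simp add: inner_add_right)
    moreover have "a \<bullet> s = 0" using assms(4) l(3) unfolding link_normal_def by blast
    ultimately have "c = 0" using ax by (simp add: inner_add_right)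
    then have "x - l = s' - s" using l(5) by (simp add: algebra_simps)
    then have "x - l \<in> span \<omega>" using l(3,4) by (simp add: span_diff span_base)
    then have "quot_map \<omega> x = quot_map \<omega> l" unfolding quot_map_eq_iff .
    then show "quot_map \<omega> x \<in> quot_support \<omega> (link \<Sigma> (\<alpha> + \<omega>))"
      unfolding quot_support_def using l(1,2) by blast
  qed
qed

text \<open>From right to left the hyperplane of \<open>a\<close> serves as \<open>H\<close>.
  Conversely, if \<open>H\<close> contained the generator of \<open>\<alpha>\<close>, then
  \<open>link_covers\<close> would make it the whole space; so the generator lies off
  \<open>H\<close>, and a functional separates it from the link and \<open>\<omega>\<close>.\<close>

lemma quot_codim1_subspace_link_iff:
  assumes "\<alpha> \<in> rays \<Sigma>" and "\<omega> \<in> \<Sigma>" and "\<alpha> + \<omega> \<in> \<Sigma>"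
  shows "quot_codim1_subspace \<omega> (quot_support \<omega> (link \<Sigma> (\<alpha> + \<omega>))) \<longleftrightarrow> (\<exists>a. link_normal \<alpha> \<omega> a)"
proof
  assume "\<exists>a. link_normal \<alpha> \<omega> a"
  then obtain a where a: "link_normal \<alpha> \<omega> a" by blast
  then have "a \<noteq> 0" unfolding link_normal_def by auto
  then have "dim {x. a \<bullet> x = 0} + 1 = CARD('n)" by (simp add: dim_hyperplane)
  moreover have "subspace {x. a \<bullet> x = 0}" by (rule subspace_hyperplane)
  moreover have "span \<omega> \<subseteq> {x. a \<bullet> x = 0}"
    using a inner_span_eq_0[of \<omega> a] unfolding link_normal_def by blast
  ultimately show "quot_codim1_subspace \<omega> (quot_support \<omega> (link \<Sigma> (\<alpha> + \<omega>)))"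
    unfolding quot_codim1_subspace_def using quot_support_link[OF assms a] by blast
next
  assume "quot_codim1_subspace \<omega> (quot_support \<omega> (link \<Sigma> (\<alpha> + \<omega>)))"
  then obtain H where H: "subspace H" "span \<omega> \<subseteq> H" "dim H + 1 = CARD('n)"
    "quot_support \<omega> (link \<Sigma> (\<alpha> + \<omega>)) = quot_map \<omega> ` H"
    unfolding quot_codim1_subspace_def by blast
  let ?u = "ray_gen {0} \<alpha>"
  have link_H: "x \<in> H" if "\<tau> \<in> link \<Sigma> (\<alpha> + \<omega>)" "x \<in> \<tau>" for \<tau> x
  proof -
    have "quot_map \<omega> x \<in> quot_map \<omega> ` H"
      using that H(4) unfolding quot_support_def by blast
    then obtain h where "h \<in> H" "x - h \<in> H" using H(2) unfolding quot_map_image_iff by blast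
    then show ?thesis using subspace_add[OF H(1), of "x - h" h] by simp
  qed
  have \<omega>_H: "\<omega> \<subseteq> H" using H(2) span_superset by blast
  have "?u \<notin> H"
  proof
    assume "?u \<in> H"
    have "x \<in> H" for x
    proof -
      obtain \<tau> l s s' c where l: "\<tau> \<in> link \<Sigma> (\<alpha> + \<omega>)" "l \<in> \<tau>" "s \<in> \<omega>" "s' \<in> \<omega>"
        "x + s = l + s' + c *\<^sub>R ?u"
        using link_covers[OF assms] .
      have "l + s' + c *\<^sub>R ?u - s \<in> H"
        using \<open>?u \<in> H\<close> link_H[OF l(1,2)] l(3,4) \<omega>_H
        by (intro subspace_diff subspace_add subspace_scale H(1)) auto
      moreover have "x = l + s' + c *\<^sub>R ?u - s" using l(5) by (metis add_diff_cancel_right')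
      ultimately show ?thesis by simp
    qed
    then have "H = UNIV" by blast
    then show False using H(3) by simp
  qed
  \<comment> \<open>Restricting to lattice points makes the functional rational; they span the
    cones, so nothing is lost.\<close>
  define S where "S = lattice_N \<inter> (\<omega> \<union> \<Union>(link \<Sigma> (\<alpha> + \<omega>)))"
  have "S \<subseteq> H" unfolding S_def using \<omega>_H link_H by blast
  then have "?u \<notin> span S" using \<open>?u \<notin> H\<close> H(1) span_minimal by blast
  moreover have "S \<subseteq> M_rat" unfolding S_def using lattice_N_subset_M_rat by blast
  moreover have "?u \<in> M_rat"
    using primitive_generator_lattice[OF assms(1)] lattice_N_subset_M_rat by blast
  ultimately obtain a where a: "a \<in> M_rat" "\<And>s. s \<in> S \<Longrightarrow> a \<bullet> s = 0" "a \<bullet> ?u = 1"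
    using rational_functional by metis
  have vanish: "a \<bullet> x = 0" if \<gamma>: "\<gamma> \<in> \<Sigma>" "lattice_N \<inter> \<gamma> \<subseteq> S" "x \<in> \<gamma>" for \<gamma> x
  proof (rule inner_span_eq_0)
    show "x \<in> span (lattice_N \<inter> \<gamma>)"
      using span_lattice_points[OF \<gamma>(1)] span_base[OF \<gamma>(3)] by simp
  qed (use a(2) \<gamma>(2) in blast)
  have "a \<bullet> x = 0" if "x \<in> \<omega>" for x
    using vanish[OF assms(2) _ that] unfolding S_def by blast
  moreover have "a \<bullet> x = 0" if "\<tau> \<in> link \<Sigma> (\<alpha> + \<omega>)" "x \<in> \<tau>" for \<tau> x
    using vanish[of \<tau> x] that unfolding S_def link_def by blast
  ultimately show "\<exists>a. link_normal \<alpha> \<omega> a"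
    unfolding link_normal_def using a(1,3) by blast
qed

text \<open>When \<open>a \<bullet> x\<close> is positive, it is the coefficient of the generator of
  \<open>\<alpha>\<close> in a decomposition of \<open>x + s\<close> within a cone of the star, so
  extremality forces \<open>\<alpha>\<close> into every cone containing the point. The further
  translation \<open>t\<close> lets the translations for two different stars be combined.\<close>

lemma link_normal_positive:
  assumes "\<alpha> \<in> rays \<Sigma>" and "\<omega> \<in> \<Sigma>" and "\<alpha> + \<omega> \<in> \<Sigma>" and "link_normal \<alpha> \<omega> a"
    and "0 < a \<bullet> x"
  obtains s \<gamma> where "s \<in> \<omega>" and "\<gamma> \<in> \<Sigma>" and "\<alpha> + \<omega> \<subseteq> \<gamma>" and "x + s \<in> \<gamma>"
    and "\<And>t \<delta>. t \<in> \<omega> \<Longrightarrow> \<delta> \<in> \<Sigma> \<Longrightarrow> x + s + t \<in> \<delta> \<Longrightarrow> \<alpha> \<subseteq> \<delta>"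
proof -
  let ?u = "ray_gen {0} \<alpha>"
  obtain \<tau> l s s' c where l: "\<tau> \<in> link \<Sigma> (\<alpha> + \<omega>)" "l \<in> \<tau>" "s \<in> \<omega>" "s' \<in> \<omega>"
    "x + s = l + s' + c *\<^sub>R ?u"
    using link_covers[OF assms(1-3)] .
  have "a \<bullet> (x + s) = c"
    using assms(4) l(1,2,4) unfolding l(5) link_normal_def by (simp add: inner_add_right)
  moreover have "a \<bullet> s = 0" using assms(4) l(3) unfolding link_normal_def by blast
  ultimately have c: "0 < c" using assms(5) by (simp add: inner_add_right)
  define \<gamma> where "\<gamma> = \<tau> + (\<alpha> + \<omega>)"
  have \<tau>: "\<tau> \<in> \<Sigma>" "\<gamma> \<in> \<Sigma>" using l(1) unfolding link_def \<gamma>_def by blast+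
  have \<alpha>: "\<alpha> \<in> \<Sigma>" using assms(1) unfolding rays_def by blast
  have sub: "\<tau> \<subseteq> \<gamma>" "\<alpha> + \<omega> \<subseteq> \<gamma>" "\<alpha> \<subseteq> \<alpha> + \<omega>" "\<omega> \<subseteq> \<alpha> + \<omega>"
    unfolding \<gamma>_def using convex_cone_subset_plus convex_cone_mem \<tau>(1) assms(2,3) \<alpha> by blast+
  note add = convex_cone_add[OF convex_cone_mem[OF \<tau>(2)]]
  have cu: "c *\<^sub>R ?u \<in> \<alpha>"
    using c primitive_generator_mem[OF assms(1)]
    by (intro convex_cone_scaleR[OF convex_cone_mem[OF \<alpha>]]) auto
  have cu_\<gamma>: "c *\<^sub>R ?u \<in> \<gamma>" using cu sub by blast
  have ls: "l + s' \<in> \<gamma>" using add l(2,4) sub by blast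
  show thesis
  proof (rule that[OF l(3) \<tau>(2) sub(2)])
    show "x + s \<in> \<gamma>" unfolding l(5) using add ls cu_\<gamma> by blast
    fix t \<delta> assume t: "t \<in> \<omega>" "\<delta> \<in> \<Sigma>" "x + s + t \<in> \<delta>"
    have "c *\<^sub>R ?u + (l + s' + t) \<in> \<delta>" using t(3) unfolding l(5) by (simp add: algebra_simps)
    moreover have "l + s' + t \<in> \<gamma>" using add ls t(1) sub by blast
    ultimately have "c *\<^sub>R ?u \<in> \<delta>" using summand_mem[OF \<tau>(2) t(2) cu_\<gamma>] by blast
    moreover have "c *\<^sub>R ?u \<noteq> 0" using c primitive_generator_nonzero[OF assms(1)] by simp
    ultimately show "\<alpha> \<subseteq> \<delta>" using ray_subset[OF assms(1) t(2) cu] by blast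
  qed
qed

section \<open>Rays in links and opposite half-spaces\<close>

lemma ray_cone_mem: "\<rho> \<in> rays \<Sigma> \<Longrightarrow> \<rho> \<in> \<Sigma>"
  by (simp add: rays_def)

lemma ray_not_subset:
  assumes "\<rho> \<in> rays \<Sigma>" and "\<rho> \<inter> \<omega> = {0}"
  shows "\<not> \<rho> \<subseteq> \<omega>"
  using primitive_generator_mem[OF assms(1)] primitive_generator_nonzero[OF assms(1)] assms(2)
  by blast

lemma ray_Int_eq_zero:
  assumes "\<rho> \<in> rays \<Sigma>" and "\<gamma> \<in> \<Sigma>" and "\<not> \<rho> \<subseteq> \<gamma>"
  shows "\<rho> \<inter> \<gamma> = {0}"
  using ray_subset[OF assms(1,2)] assms(3) zero_mem[OF assms(2)] zero_mem[OF ray_cone_mem[OF assms(1)]]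
  by blast

lemma Cone_pair:
  assumes "\<alpha> \<in> \<Sigma>" and "\<omega> \<in> \<Sigma>"
  shows "Cone {\<alpha>, \<omega>} = \<alpha> + \<omega>"
proof -
  have "Cone {\<omega>} = \<omega>"
    unfolding Cone_def using hull_same[of convex_cone, OF convex_cone_mem[OF assms(2)]] by simp
  then show ?thesis
    unfolding Cone_insert using hull_same[of convex_cone, OF convex_cone_mem[OF assms(1)]] by simp
qed

text \<open>Adding the rays one at a time stays within the face lattice of \<open>\<gamma>\<close>,
  and extremality shows that no further ray appears. The last clause later separates the omitted ray
  from the cone of the others.\<close>

lemma Cone_rays:
  assumes "finite R" and "R \<subseteq> rays \<Sigma>" and "\<gamma> \<in> \<Sigma>" and "\<And>\<rho>. \<rho> \<in> R \<Longrightarrow> \<rho> \<subseteq> \<gamma>"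
  shows "Cone R \<in> \<Sigma> \<and> Cone R \<subseteq> \<gamma> \<and> (\<forall>\<alpha>\<in>rays \<Sigma>. \<alpha> \<subseteq> Cone R \<longrightarrow> \<alpha> \<in> R)"
  using assms(1,2,4)
proof (induction R)
  case empty
  have "Cone {} = {0}" unfolding Cone_def by simp
  moreover have "\<not> \<alpha> \<subseteq> {0}" if "\<alpha> \<in> rays \<Sigma>" for \<alpha>
    using primitive_generator_mem[OF that] primitive_generator_nonzero[OF that] by blast
  ultimately show ?case using zero_cone_mem zero_mem[OF assms(3)] by auto
next
  case (insert \<rho> R)
  have \<rho>: "\<rho> \<in> rays \<Sigma>" "\<rho> \<in> \<Sigma>" "\<rho> \<subseteq> \<gamma>" using insert.prems ray_cone_mem by auto
  have IH: "Cone R \<in> \<Sigma>" "Cone R \<subseteq> \<gamma>" "\<And>\<alpha>. \<alpha> \<in> rays \<Sigma> \<Longrightarrow> \<alpha> \<subseteq> Cone R \<Longrightarrow> \<alpha> \<in> R"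
    using insert by auto
  have eq: "Cone (insert \<rho> R) = \<rho> + Cone R"
    unfolding Cone_insert using hull_same[of convex_cone, OF convex_cone_mem[OF \<rho>(2)]] by simp
  have mem: "\<rho> + Cone R \<in> \<Sigma>" by (rule plus_mem[OF assms(3) \<rho>(2) IH(1) \<rho>(3) IH(2)])
  moreover have "\<rho> + Cone R \<subseteq> \<gamma>"
    by (rule convex_cone_plus_least[OF convex_cone_mem[OF assms(3)] \<rho>(3) IH(2)])
  moreover have "\<alpha> \<in> insert \<rho> R" if "\<alpha> \<in> rays \<Sigma>" "\<alpha> \<subseteq> \<rho> + Cone R" for \<alpha>
    using ray_subset_plus[OF that(1) \<rho>(2) IH(1) mem that(2)] rays_subset_eq[OF that(1) \<rho>(1)]
      IH(3)[OF that(1)] by blast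
  ultimately show ?case unfolding eq by blast
qed

text \<open>The flag property: the star of \<open>\<alpha>\<close> is convex, so it contains a relative interior point of
  \<open>\<beta> + \<omega>\<close>, and the cone of the star in which this point lies has both \<open>\<beta> + \<omega>\<close> and \<open>\<alpha>\<close> as faces.\<close>

lemma ray_in_link_plus_iff:
  assumes "locally_convex \<Sigma>" and "\<alpha> \<in> rays \<Sigma>" and "\<beta> \<in> rays \<Sigma>" and "\<beta> \<noteq> \<alpha>"
    and "\<omega> \<in> \<Sigma>" and "\<alpha> + \<omega> \<in> \<Sigma>" and "\<beta> \<in> link \<Sigma> \<omega>"
  shows "\<beta> \<in> link \<Sigma> \<alpha> \<longleftrightarrow> \<beta> \<in> link \<Sigma> (\<alpha> + \<omega>)"
proof
  note \<alpha> = ray_cone_mem[OF assms(2)] and \<beta> = ray_cone_mem[OF assms(3)]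
  have \<beta>\<omega>: "\<beta> \<inter> \<omega> = {0}" "\<beta> + \<omega> \<in> \<Sigma>" using assms(7) unfolding link_def by blast+
  note sub = convex_cone_subset_plus[OF convex_cone_mem[OF \<alpha>] convex_cone_mem[OF assms(5)]]
  {
    assume "\<beta> \<in> link \<Sigma> (\<alpha> + \<omega>)"
    then have l: "\<beta> \<inter> (\<alpha> + \<omega>) = {0}" "\<beta> + (\<alpha> + \<omega>) \<in> \<Sigma>" unfolding link_def by blast+
    note sub' = convex_cone_subset_plus[OF convex_cone_mem[OF \<beta>] convex_cone_mem[OF assms(6)]]
    have "\<beta> + \<alpha> \<in> \<Sigma>" using plus_mem[OF l(2) \<beta> \<alpha>] sub sub' by blast
    moreover have "\<not> \<beta> \<subseteq> \<alpha>" using rays_subset_eq[OF assms(3,2)] assms(4) by blast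
    ultimately show "\<beta> \<in> link \<Sigma> \<alpha>"
      unfolding link_def using ray_Int_eq_zero[OF assms(3) \<alpha>] \<beta> by blast
  next
    assume "\<beta> \<in> link \<Sigma> \<alpha>"
    then have \<beta>\<alpha>: "\<beta> + \<alpha> \<in> \<Sigma>" unfolding link_def by blast
    note sub' = convex_cone_subset_plus[OF convex_cone_mem[OF \<beta>] convex_cone_mem[OF \<alpha>]]
    let ?U = "\<Union>{\<gamma> \<in> \<Sigma>. \<alpha> \<subseteq> \<gamma>}"
    have U: "convex ?U" using assms(1,2) unfolding locally_convex_def by blast
    have "\<beta> \<subseteq> ?U" using \<beta>\<alpha> sub' by blast
    have "\<omega> \<subseteq> ?U" using assms(6) sub by blast
    obtain p where p: "p \<in> \<beta> + \<omega>" "\<And>\<gamma>. \<gamma> \<in> \<Sigma> \<Longrightarrow> p \<in> \<gamma> \<Longrightarrow> \<beta> + \<omega> \<subseteq> \<gamma>"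
      using relative_interior_point[OF \<beta>\<omega>(2)] by blast
    from p(1) obtain b w where bw: "p = b + w" "b \<in> \<beta>" "w \<in> \<omega>" by (rule set_plus_elim)
    \<comment> \<open>Convexity of the star gives only the midpoint of \<open>b\<close> and
      \<open>w\<close>; the cone containing it also contains its double \<open>p\<close>.\<close>
    have "(1/2) *\<^sub>R b + (1/2) *\<^sub>R w \<in> ?U"
      using U bw(2,3) \<open>\<beta> \<subseteq> ?U\<close> \<open>\<omega> \<subseteq> ?U\<close> by (intro convexD) auto
    then obtain \<gamma> where \<gamma>: "\<gamma> \<in> \<Sigma>" "\<alpha> \<subseteq> \<gamma>" "(1/2) *\<^sub>R b + (1/2) *\<^sub>R w \<in> \<gamma>" by blast
    have "2 *\<^sub>R ((1/2) *\<^sub>R b + (1/2) *\<^sub>R w) \<in> \<gamma>"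
      by (rule convex_cone_scaleR[OF convex_cone_mem[OF \<gamma>(1)] _ \<gamma>(3)]) simp
    then have "p \<in> \<gamma>" unfolding bw(1) by (simp add: scaleR_add_right)
    then have "\<beta> + \<omega> \<subseteq> \<gamma>" using p(2) \<gamma>(1) by blast
    then have "\<beta> \<subseteq> \<gamma>" "\<omega> \<subseteq> \<gamma>"
      using convex_cone_subset_plus[OF convex_cone_mem[OF \<beta>] convex_cone_mem[OF assms(5)]] by blast+
    then have "\<beta> + (\<alpha> + \<omega>) \<in> \<Sigma>"
      using convex_cone_plus_least[OF convex_cone_mem[OF \<gamma>(1)] \<gamma>(2)]
      by (intro plus_mem[OF \<gamma>(1) \<beta> assms(6)]) auto
    moreover have "\<not> \<beta> \<subseteq> \<alpha> + \<omega>"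
      using ray_subset_plus[OF assms(3) \<alpha> assms(5,6)] rays_subset_eq[OF assms(3,2)] assms(4)
        ray_not_subset[OF assms(3) \<beta>\<omega>(1)] by blast
    ultimately show "\<beta> \<in> link \<Sigma> (\<alpha> + \<omega>)"
      unfolding link_def using ray_Int_eq_zero[OF assms(3,6)] \<beta> by blast
  }
qed

text \<open>The stars of \<open>\<alpha> + \<omega>\<close> and \<open>\<beta> + \<omega>\<close> fill the half-spaces \<open>0 \<le> a \<bullet> x\<close> and \<open>0 \<le> b \<bullet> x\<close> modulo
  \<open>span \<omega>\<close>. A common interior point would lie in a cone containing both rays.\<close>

lemma link_normals_opposite:
  assumes "\<alpha> \<in> rays \<Sigma>" and "\<beta> \<in> rays \<Sigma>" and "\<beta> \<noteq> \<alpha>" and "\<beta> \<notin> link \<Sigma> \<alpha>"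
    and "\<omega> \<in> \<Sigma>" and "\<alpha> + \<omega> \<in> \<Sigma>" and "\<beta> + \<omega> \<in> \<Sigma>"
    and "link_normal \<alpha> \<omega> a" and "link_normal \<beta> \<omega> b"
  obtains c where "0 < c" and "b = - c *\<^sub>R a"
proof -
  note \<alpha> = ray_cone_mem[OF assms(1)] and \<beta> = ray_cone_mem[OF assms(2)]
  note sub = convex_cone_subset_plus[OF convex_cone_mem[OF \<beta>] convex_cone_mem[OF assms(5)]]
  have "b \<bullet> x \<le> 0" if ax: "0 < a \<bullet> x" for x
  proof (rule ccontr)
    assume "\<not> b \<bullet> x \<le> 0"
    then have bx: "0 < b \<bullet> x" by simp
    obtain s where s: "s \<in> \<omega>" "\<And>t \<delta>. t \<in> \<omega> \<Longrightarrow> \<delta> \<in> \<Sigma> \<Longrightarrow> x + s + t \<in> \<delta> \<Longrightarrow> \<alpha> \<subseteq> \<delta>"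
      using link_normal_positive[OF assms(1,5,6,8) ax] by metis
    obtain t \<gamma> where t: "t \<in> \<omega>" "\<gamma> \<in> \<Sigma>" "\<beta> + \<omega> \<subseteq> \<gamma>" "x + t \<in> \<gamma>"
      using link_normal_positive[OF assms(2,5,7,9) bx] by metis
    have "s \<in> \<gamma>" "\<beta> \<subseteq> \<gamma>" using s(1) t(3) sub by blast+
    \<comment> \<open>One point must serve both stars: \<open>x + t\<close> lies in a cone around
      \<open>\<beta> + \<omega>\<close>, and adding \<open>s\<close> from \<open>\<omega>\<close>
      keeps it there while making it a point that forces \<open>\<alpha>\<close> into the
      cone.\<close>
    then have "(x + t) + s \<in> \<gamma>" 
      using convex_cone_add[OF convex_cone_mem[OF t(2)] t(4)] by blast
    then have "x + s + t \<in> \<gamma>" by (simp add: add_ac)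
    then have "\<alpha> \<subseteq> \<gamma>" using s(2) t(1,2) by blast
    then have "\<beta> + \<alpha> \<in> \<Sigma>" using plus_mem[OF t(2) \<beta> \<alpha> \<open>\<beta> \<subseteq> \<gamma>\<close>] by blast
    moreover have "\<not> \<beta> \<subseteq> \<alpha>" using rays_subset_eq[OF assms(2,1)] assms(3) by blast
    ultimately have "\<beta> \<in> link \<Sigma> \<alpha>"
      unfolding link_def using ray_Int_eq_zero[OF assms(2) \<alpha>] \<beta> by blast
    then show False using assms(4) by blast
  qed
  moreover have "a \<noteq> 0" "b \<noteq> 0" using assms(8,9) unfolding link_normal_def by auto
  ultimately show thesis using opposite_vectors that by metis
qed

text \<open>The generator of \<open>\<beta>\<close> lies strictly on the positive side of
  \<open>\<alpha>\<close>, so after a translation within \<open>\<omega>\<close> every cone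
  containing it contains \<open>\<alpha>\<close>. The cone \<open>\<beta> + \<omega>\<close> is one,
  and its rays outside \<open>\<omega>\<close> reduce to \<open>\<beta>\<close>.\<close>

lemma link_normal_proportional_eq:
  assumes "\<alpha> \<in> rays \<Sigma>" and "\<beta> \<in> rays \<Sigma>" and "\<omega> \<in> \<Sigma>" and "\<not> \<alpha> \<subseteq> \<omega>"
    and "\<alpha> + \<omega> \<in> \<Sigma>" and "\<beta> + \<omega> \<in> \<Sigma>"
    and "link_normal \<alpha> \<omega> a" and "0 < a \<bullet> ray_gen {0} \<beta>"
  shows "\<alpha> = \<beta>"
proof -
  let ?u = "ray_gen {0} \<beta>"
  note \<beta> = ray_cone_mem[OF assms(2)]
  obtain s where s: "s \<in> \<omega>" "\<And>t \<delta>. t \<in> \<omega> \<Longrightarrow> \<delta> \<in> \<Sigma> \<Longrightarrow> ?u + s + t \<in> \<delta> \<Longrightarrow> \<alpha> \<subseteq> \<delta>"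
    using link_normal_positive[OF assms(1,3,5,7,8)] by metis
  have "?u + s + 0 \<in> \<beta> + \<omega>" using primitive_generator_mem[OF assms(2)] s(1) by auto
  then have "\<alpha> \<subseteq> \<beta> + \<omega>" using s(2) zero_mem[OF assms(3)] assms(6) by blast
  then show ?thesis
    using ray_subset_plus[OF assms(1) \<beta> assms(3,6)] assms(4) rays_subset_eq[OF assms(1,2)] by blast
qed

end

theorem proposition1p14:
  fixes \<Sigma> :: "(real ^ 'n) set set"
    and \<rho> :: "nat \<Rightarrow> (real ^ 'n) set"
    and m r :: nat
    and \<sigma> \<sigma>' :: "(real ^ 'n) set"
  assumes "fan \<Sigma>" and "complete_fan \<Sigma>" and "simplicial_fan \<Sigma>" and "locally_convex \<Sigma>"
    and "\<forall>k\<in>{1..m}. \<rho> k \<in> rays \<Sigma>" and "inj_on \<rho> {1..m}"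
    and "1 \<le> r" and "r \<le> m"
    and "\<sigma> = Cone (\<rho> ` {1..m})" and "\<sigma> \<in> \<Sigma>"
    and "\<sigma>' = Cone (\<rho> ` ({1..m} - {r}))"
  shows
    "(\<forall>\<alpha>\<in>rays \<Sigma> \<inter> link \<Sigma> \<sigma>'. \<alpha> \<noteq> \<rho> r \<longrightarrow>
        (restricts_to_zero \<Sigma> (- prime_divisor \<alpha>) (Cone {\<alpha>, \<sigma>'}) \<longleftrightarrow>
         quot_codim1_subspace \<sigma>' (quot_support \<sigma>' (link \<Sigma> (Cone {\<alpha>, \<sigma>'}))))) \<and>
     (\<forall>\<beta>\<in>rays \<Sigma> \<inter> link \<Sigma> \<sigma>'. \<beta> \<noteq> \<rho> r \<longrightarrow>
        (\<beta> \<notin> link \<Sigma> (\<rho> r) \<longleftrightarrow> \<beta> \<notin> link \<Sigma> \<sigma>)) \<and>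
     (restricts_to_zero \<Sigma> (- prime_divisor (\<rho> r)) \<sigma> \<and>
      (\<exists>\<alpha>\<in>rays \<Sigma> \<inter> link \<Sigma> \<sigma>'. \<alpha> \<noteq> \<rho> r \<and>
         restricts_to_zero \<Sigma> (- prime_divisor \<alpha>) (Cone {\<alpha>, \<sigma>'})) \<longrightarrow>
      (\<exists>\<^sub>\<le>\<^sub>1 \<beta>. \<beta> \<in> rays \<Sigma> \<inter> link \<Sigma> \<sigma>' \<and> \<beta> \<noteq> \<rho> r \<and> \<beta> \<notin> link \<Sigma> (\<rho> r) \<and>
         restricts_to_zero \<Sigma> (- prime_divisor \<beta>) (Cone {\<beta>, \<sigma>'})) \<and>
      (\<forall>\<beta>\<in>rays \<Sigma> \<inter> link \<Sigma> \<sigma>'. \<beta> \<noteq> \<rho> r \<and> \<beta> \<notin> link \<Sigma> (\<rho> r) \<and>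
         restricts_to_zero \<Sigma> (- prime_divisor \<beta>) (Cone {\<beta>, \<sigma>'}) \<longrightarrow>
         quot_support \<sigma>' (link \<Sigma> (Cone {\<beta>, \<sigma>'})) = quot_support \<sigma>' (link \<Sigma> \<sigma>)))"
proof -
  interpret complete_simplicial_fan \<Sigma> using assms(1-3) by unfold_locales
  have r: "r \<in> {1..m}" using assms(7,8) by simp
  then have \<rho>r: "\<rho> r \<in> rays \<Sigma>" using assms(5) by blast
  have "\<rho> k \<subseteq> \<sigma>" if "k \<in> {1..m}" for k
    unfolding assms(9) Cone_def using that by (intro order_trans[OF _ hull_subset]) blast
  then have \<sigma>': "\<sigma>' \<in> \<Sigma>" "\<And>\<alpha>. \<alpha> \<in> rays \<Sigma> \<Longrightarrow> \<alpha> \<subseteq> \<sigma>' \<Longrightarrow> \<alpha> \<in> \<rho> ` ({1..m} - {r})"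
    unfolding assms(11) using Cone_rays[of "\<rho> ` ({1..m} - {r})" \<sigma>] assms(5,10) by blast+
  \<comment> \<open>The rays of \<open>\<sigma>'\<close> are exactly the remaining ones, and
    injectivity of \<open>\<rho>\<close> keeps \<open>\<rho> r\<close> from recurring among
    them.\<close>
  have not_sub: "\<not> \<rho> r \<subseteq> \<sigma>'"
    using \<sigma>'(2)[OF \<rho>r] inj_onD[OF assms(6)] r by blast
  have "\<rho> ` {1..m} = insert (\<rho> r) (\<rho> ` ({1..m} - {r}))" using r by blast
  then have \<sigma>: "\<sigma> = \<rho> r + \<sigma>'"
    unfolding assms(9,11) Cone_insert
    using Cone_insert hull_same[of convex_cone, OF convex_cone_mem[OF ray_cone_mem[OF \<rho>r]]] by metis
  have \<sigma>_mem: "\<rho> r + \<sigma>' \<in> \<Sigma>" using assms(10) \<sigma> by simp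
  have link: "\<alpha> + \<sigma>' \<in> \<Sigma>" "\<not> \<alpha> \<subseteq> \<sigma>'" "Cone {\<alpha>, \<sigma>'} = \<alpha> + \<sigma>'"
    if "\<alpha> \<in> rays \<Sigma> \<inter> link \<Sigma> \<sigma>'" for \<alpha>
    using that ray_not_subset[of \<alpha> \<sigma>'] Cone_pair[OF ray_cone_mem \<sigma>'(1), of \<alpha>]
    unfolding link_def by auto
  have normal: "restricts_to_zero \<Sigma> (- prime_divisor \<alpha>) (\<alpha> + \<sigma>') \<longleftrightarrow> (\<exists>a. link_normal \<alpha> \<sigma>' a)"
    if "\<alpha> \<in> rays \<Sigma>" "\<not> \<alpha> \<subseteq> \<sigma>'" "\<alpha> + \<sigma>' \<in> \<Sigma>" for \<alpha>
    using restricts_to_zero_imp_link_normal[OF that(1) \<sigma>'(1) that(2,3)]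
      link_normal_imp_restricts_to_zero[OF that(1) \<sigma>'(1) that(2,3)] by blast
  show ?thesis
  proof (intro conjI impI ballI)
    fix \<alpha> assume \<alpha>: "\<alpha> \<in> rays \<Sigma> \<inter> link \<Sigma> \<sigma>'"
    then show "restricts_to_zero \<Sigma> (- prime_divisor \<alpha>) (Cone {\<alpha>, \<sigma>'}) \<longleftrightarrow>
        quot_codim1_subspace \<sigma>' (quot_support \<sigma>' (link \<Sigma> (Cone {\<alpha>, \<sigma>'})))"
      using normal[of \<alpha>] link[OF \<alpha>] quot_codim1_subspace_link_iff[of \<alpha> \<sigma>'] \<sigma>'(1) by simp
  next
    fix \<beta> assume "\<beta> \<in> rays \<Sigma> \<inter> link \<Sigma> \<sigma>'" "\<beta> \<noteq> \<rho> r"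
    then show "\<beta> \<notin> link \<Sigma> (\<rho> r) \<longleftrightarrow> \<beta> \<notin> link \<Sigma> \<sigma>"
      using ray_in_link_plus_iff[OF assms(4) \<rho>r _ _ \<sigma>'(1) \<sigma>_mem, of \<beta>] \<sigma> by blast
  next
    assume "restricts_to_zero \<Sigma> (- prime_divisor (\<rho> r)) \<sigma> \<and>
      (\<exists>\<alpha>\<in>rays \<Sigma> \<inter> link \<Sigma> \<sigma>'. \<alpha> \<noteq> \<rho> r \<and>
         restricts_to_zero \<Sigma> (- prime_divisor \<alpha>) (Cone {\<alpha>, \<sigma>'}))"
    then obtain a where a: "link_normal (\<rho> r) \<sigma>' a" using normal[OF \<rho>r not_sub \<sigma>_mem] \<sigma> by blast
    \<comment> \<open>Every candidate \<open>\<beta>\<close> is compared with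
      \<open>\<rho> r\<close>, whose normal \<open>a\<close> is fixed once; uniqueness and the
      equality of supports are then statements about multiples of \<open>a\<close>.\<close>
    have opposite: "\<exists>b c. link_normal \<beta> \<sigma>' b \<and> 0 < c \<and> b = - c *\<^sub>R a"
      if \<beta>: "\<beta> \<in> rays \<Sigma> \<inter> link \<Sigma> \<sigma>'" "\<beta> \<noteq> \<rho> r \<and> \<beta> \<notin> link \<Sigma> (\<rho> r) \<and>
        restricts_to_zero \<Sigma> (- prime_divisor \<beta>) (Cone {\<beta>, \<sigma>'})" for \<beta>
    proof -
      note l = link[OF \<beta>(1)]
      obtain b where b: "link_normal \<beta> \<sigma>' b" using normal[of \<beta>] \<beta> l by auto
      obtain c where "0 < c" "b = - c *\<^sub>R a"
        using link_normals_opposite[OF \<rho>r _ _ _ \<sigma>'(1) \<sigma>_mem l(1) a b] \<beta> by blast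
      with b show ?thesis by blast
    qed
    show "\<exists>\<^sub>\<le>\<^sub>1 \<beta>. \<beta> \<in> rays \<Sigma> \<inter> link \<Sigma> \<sigma>' \<and> \<beta> \<noteq> \<rho> r \<and> \<beta> \<notin> link \<Sigma> (\<rho> r) \<and>
         restricts_to_zero \<Sigma> (- prime_divisor \<beta>) (Cone {\<beta>, \<sigma>'})"
    proof (rule Uniq_I)
      fix \<beta> \<gamma>
      assume \<beta>: "\<beta> \<in> rays \<Sigma> \<inter> link \<Sigma> \<sigma>' \<and> \<beta> \<noteq> \<rho> r \<and> \<beta> \<notin> link \<Sigma> (\<rho> r) \<and>
         restricts_to_zero \<Sigma> (- prime_divisor \<beta>) (Cone {\<beta>, \<sigma>'})"
      assume \<gamma>: "\<gamma> \<in> rays \<Sigma> \<inter> link \<Sigma> \<sigma>' \<and> \<gamma> \<noteq> \<rho> r \<and> \<gamma> \<notin> link \<Sigma> (\<rho> r) \<and>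
         restricts_to_zero \<Sigma> (- prime_divisor \<gamma>) (Cone {\<gamma>, \<sigma>'})"
      obtain b c where b: "link_normal \<beta> \<sigma>' b" "0 < c" "b = - c *\<^sub>R a" using opposite \<beta> by blast
      obtain b' d where b': "link_normal \<gamma> \<sigma>' b'" "0 < d" "b' = - d *\<^sub>R a" using opposite \<gamma> by blast
      \<comment> \<open>Two negative multiples of \<open>a\<close> are positive multiples of each
        other, and \<open>b'\<close> is 1 on the generator of \<open>\<gamma>\<close>; so that
        generator is on the positive side of \<open>\<beta>\<close>.\<close>
      have "b = (c / d) *\<^sub>R b'" unfolding b(3) b'(3) using b'(2) by simp
      moreover have "b' \<bullet> ray_gen {0} \<gamma> = 1" using b'(1) unfolding link_normal_def by blast
      ultimately have "0 < b \<bullet> ray_gen {0} \<gamma>" using b(2) b'(2) by simp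
      then show "\<beta> = \<gamma>"
        using link_normal_proportional_eq[OF _ _ \<sigma>'(1) _ _ _ b(1)] link[of \<beta>] link[of \<gamma>] \<beta> \<gamma> by blast
    qed
    fix \<beta>
    assume \<beta>: "\<beta> \<in> rays \<Sigma> \<inter> link \<Sigma> \<sigma>'" "\<beta> \<noteq> \<rho> r \<and> \<beta> \<notin> link \<Sigma> (\<rho> r) \<and>
         restricts_to_zero \<Sigma> (- prime_divisor \<beta>) (Cone {\<beta>, \<sigma>'})"
    obtain b c where b: "link_normal \<beta> \<sigma>' b" "0 < c" "b = - c *\<^sub>R a" using opposite[OF \<beta>] by blast
    have "{x. b \<bullet> x = 0} = {x. a \<bullet> x = 0}" unfolding b(3) using b(2) by simp
    then show "quot_support \<sigma>' (link \<Sigma> (Cone {\<beta>, \<sigma>'})) = quot_support \<sigma>' (link \<Sigma> \<sigma>)"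
      using quot_support_link[OF _ \<sigma>'(1) _ b(1)] quot_support_link[OF \<rho>r \<sigma>'(1) \<sigma>_mem a]
        link[OF \<beta>(1)] \<beta>(1) \<sigma> by simp
  qed
qed

end
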